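(* Let $I$ be a compact interval, $\beta>1$, and let $f:I\to\mathcal{K}_c(\mathbb{R})$ be continuous with $\dim_H\mathcal{G}_*(f)\ge\beta$. Then there exist $g_*,h_*\in\mathcal{D}_\beta$ such that $f=g_*\oplus h_*$, where $\mathcal{D}_\beta=\{g\in\mathcal{C}(I,\mathcal{K}_c(\mathbb{R})):\dim_H\mathcal{G}_*(g)=\beta\}$.
   Context: $\mathcal{K}_c(\mathbb{R})$: non-empty compact convex subsets of $\mathbb{R}$; $\mathcal{C}(I,\mathcal{K}_c(\mathbb{R}))$: continuous maps $I\to\mathcal{K}_c(\mathbb{R})$ with respect to the Hausdorff distance $\mathfrak{H}$. $(g\oplus h)(x)=g(x)\oplus h(x)$ where $A\oplus B=\{a+b:(a,b)\in\Lambda(A,B)\}$, $\Lambda(A,B)=\{(a,b)\in A\times B:a\in\Lambda_A(b)\text{ or }b\in\Lambda_B(a)\}$, $\Lambda_A(b)=\{a\in A:|b-a|=\min_{a'\in A}|b-a'|\}$. $\mathcal{G}_*(g)=\{(x,g(x)):x\in I\}$ with metric $d((x,Y),(y,Z))=|x-y|+\mathfrak{H}(Y,Z)$; $\dim_H$ is Hausdorff dimension. *)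

theory Defs
  imports "HOL-Analysis.Analysis"
begin

definition Kc :: "real set set" where
  "Kc = {A. A \<noteq> {} \<and> compact A \<and> convex A}"

definition hausdorff_dist :: "real set \<Rightarrow> real set \<Rightarrow> real" where
  "hausdorff_dist A B = max (SUP a\<in>A. infdist a B) (SUP b\<in>B. infdist b A)"

definition cont_Kc :: "real set \<Rightarrow> (real \<Rightarrow> real set) \<Rightarrow> bool" where
  "cont_Kc I g \<longleftrightarrow> (\<forall>x\<in>I. g x \<in> Kc) \<and>
     (\<forall>x\<in>I. \<forall>e>0. \<exists>d>0. \<forall>y\<in>I. \<bar>y - x\<bar> < d \<longrightarrow> hausdorff_dist (g y) (g x) < e)"

definition nearest :: "real set \<Rightarrow> real \<Rightarrow> real set" where
  "nearest A b = {a\<in>A. \<bar>b - a\<bar> = (INF a'\<in>A. \<bar>b - a'\<bar>)}"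

definition Lambda_pairs :: "real set \<Rightarrow> real set \<Rightarrow> (real \<times> real) set" where
  "Lambda_pairs A B = {(a, b). a \<in> A \<and> b \<in> B \<and> (a \<in> nearest A b \<or> b \<in> nearest B a)}"

definition ksum :: "real set \<Rightarrow> real set \<Rightarrow> real set" where
  "ksum A B = {a + b | a b. (a, b) \<in> Lambda_pairs A B}"

definition diam_d :: "('a \<Rightarrow> 'a \<Rightarrow> real) \<Rightarrow> 'a set \<Rightarrow> ennreal" where
  "diam_d d U = (SUP (x, y)\<in>U \<times> U. ennreal (d x y))"

definition hausdorff_content :: "('a \<Rightarrow> 'a \<Rightarrow> real) \<Rightarrow> real \<Rightarrow> real \<Rightarrow> 'a set \<Rightarrow> ennreal" where
  "hausdorff_content d s \<delta> A =
     (INF U\<in>{U :: nat \<Rightarrow> 'a set. A \<subseteq> (\<Union>i. U i) \<and> (\<forall>i. diam_d d (U i) \<le> ennreal \<delta>)}.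
        (\<Sum>i. ennreal (enn2real (diam_d d (U i)) powr s)))"

definition hausdorff_measure :: "('a \<Rightarrow> 'a \<Rightarrow> real) \<Rightarrow> real \<Rightarrow> 'a set \<Rightarrow> ennreal" where
  "hausdorff_measure d s A = (SUP \<delta>\<in>{0<..}. hausdorff_content d s \<delta> A)"

definition hausdorff_dim :: "('a \<Rightarrow> 'a \<Rightarrow> real) \<Rightarrow> 'a set \<Rightarrow> ereal" where
  "hausdorff_dim d A = Inf {ereal s | s. s \<ge> 0 \<and> hausdorff_measure d s A = 0}"

definition graph_metric :: "real \<times> real set \<Rightarrow> real \<times> real set \<Rightarrow> real" where
  "graph_metric p q = \<bar>fst p - fst q\<bar> + hausdorff_dist (snd p) (snd q)"

definition graph_star :: "real set \<Rightarrow> (real \<Rightarrow> real set) \<Rightarrow> (real \<times> real set) set" where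
  "graph_star I g = {(x, g x) | x. x \<in> I}"

definition D_beta :: "real set \<Rightarrow> real \<Rightarrow> (real \<Rightarrow> real set) set" where
  "D_beta I \<beta> = {g. cont_Kc I g \<and> hausdorff_dim graph_metric (graph_star I g) = ereal \<beta>}"

end

theory Submission
  imports Defs "HOL-Real_Asymp.Real_Asymp"
begin

text \<open>
  A value in \<open>Kc\<close> is an interval \<open>{l..l + w}\<close>, the Hausdorff distance of two intervals is the maximum of
  the distances of their endpoints, and their metric sum is their Minkowski sum. So the dimension
  of the graph of \<open>f\<close> is that of the graph of the corresponding \<open>u = (l, w)\<close> in the Euclidean space
  \<open>\<real> \<times> \<real>\<^sup>2\<close>, and \<open>u\<close> has to be written as \<open>v + (u - v)\<close> with \<open>0 \<le> snd v \<le> snd u\<close>.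

  By a theorem of Besicovitch there is a compact set \<open>K\<close> over which the graph of \<open>u\<close> has dimension
  exactly \<open>\<beta>\<close>. Consider the complete metric space of all such \<open>v\<close> with \<open>v = u/2\<close> on \<open>K\<close>. That the part
  of the graph of \<open>v\<close> at distance at least \<open>\<rho>\<close> from \<open>K\<close> is covered by \<open>N\<close> sets of diameter \<open>d\<close> with
  \<open>N d\<^sup>\<beta> < \<rho>\<close> is an open condition on \<open>v\<close>, and a dense one since Lipschitz functions satisfy it for
  \<open>\<beta> > 1\<close>. By Baire's theorem some \<open>v\<close> satisfies it together with \<open>u - v\<close> for all \<open>\<rho> > 0\<close>; off \<open>K\<close> both
  graphs then have \<open>\<beta>\<close>-dimensional measure zero.
\<close>

subsection \<open>Null sets of Hausdorff measures and Hausdorff dimension\<close>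

definition gauged_cover ::
    "('a \<Rightarrow> 'a \<Rightarrow> real) \<Rightarrow> 'i set \<Rightarrow> ('i \<Rightarrow> 'a set) \<Rightarrow> ('i \<Rightarrow> real) \<Rightarrow> 'a set \<Rightarrow> bool" where
  "gauged_cover d J U w A \<longleftrightarrow>
     A \<subseteq> (\<Union>j\<in>J. U j) \<and> (\<forall>j\<in>J. 0 \<le> w j \<and> (\<forall>x\<in>U j. \<forall>y\<in>U j. d x y \<le> w j))"

definition cover_content_less :: "('a \<Rightarrow> 'a \<Rightarrow> real) \<Rightarrow> real \<Rightarrow> real \<Rightarrow> 'a set \<Rightarrow> bool" where
  "cover_content_less d s e A \<longleftrightarrow> (\<exists>(U :: nat \<Rightarrow> 'a set) w.
     gauged_cover d UNIV U w A \<and> (\<Sum>i. ennreal (w i powr s)) < ennreal e)"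

lemma cover_content_lessI:
  fixes U :: "nat \<Rightarrow> 'a set"
  assumes "gauged_cover d UNIV U w A" "(\<Sum>i. ennreal (w i powr s)) < ennreal e"
  shows "cover_content_less d s e A"
  using assms unfolding cover_content_less_def by blast

lemma cover_content_lessE:
  assumes "cover_content_less d s e A"
  obtains U :: "nat \<Rightarrow> 'a set" and w
  where "gauged_cover d UNIV U w A" "(\<Sum>i. ennreal (w i powr s)) < ennreal e"
  using assms unfolding cover_content_less_def by blast

lemma gauged_cover_subset: "gauged_cover d J U w B \<Longrightarrow> A \<subseteq> B \<Longrightarrow> gauged_cover d J U w A"
  unfolding gauged_cover_def by blast

lemma hausdorff_content_le_gauged_cover:
  fixes U :: "nat \<Rightarrow> 'a set"
  assumes cover: "gauged_cover d UNIV U w A" and "0 \<le> s" and le: "\<And>i. w i \<le> \<delta>"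
  shows "hausdorff_content d s \<delta> A \<le> (\<Sum>i. ennreal (w i powr s))"
proof -
  have w_nonneg: "0 \<le> w i" for i
    using cover by (simp add: gauged_cover_def)
  have diam: "diam_d d (U i) \<le> ennreal (w i)" for i
    unfolding diam_d_def using cover by (auto simp: gauged_cover_def intro!: SUP_least ennreal_leI)
  then have "diam_d d (U i) \<le> ennreal \<delta>" for i
    using ennreal_leI[OF le] by (rule order_trans)
  then have "hausdorff_content d s \<delta> A \<le> (\<Sum>i. ennreal (enn2real (diam_d d (U i)) powr s))"
    unfolding hausdorff_content_def using cover by (auto simp: gauged_cover_def intro: INF_lower)
  also have "\<dots> \<le> (\<Sum>i. ennreal (w i powr s))"
    using enn2real_mono[OF diam] w_nonneg \<open>0 \<le> s\<close>
    by (intro suminf_le ennreal_leI powr_mono2) auto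
  finally show ?thesis .
qed

lemma hausdorff_content_less_gauged_coverE:
  assumes "hausdorff_content d s \<delta> A < e"
  obtains U :: "nat \<Rightarrow> 'a set" and w
  where "gauged_cover d UNIV U w A" "(\<Sum>i. ennreal (w i powr s)) < e"
proof -
  obtain U :: "nat \<Rightarrow> 'a set" where U: "A \<subseteq> (\<Union>i. U i)" "\<And>i. diam_d d (U i) \<le> ennreal \<delta>"
      "(\<Sum>i. ennreal (enn2real (diam_d d (U i)) powr s)) < e"
    using assms unfolding hausdorff_content_def INF_less_iff by auto
  have "d x y \<le> enn2real (diam_d d (U i))" if "x \<in> U i" "y \<in> U i" for x y i
  proof -
    have "ennreal (d x y) \<le> diam_d d (U i)"
      unfolding diam_d_def by (rule SUP_upper2[of "(x, y)"]) (use that in auto)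
    also have "\<dots> = ennreal (enn2real (diam_d d (U i)))"
      using le_less_trans[OF U(2)] by (intro ennreal_enn2real[symmetric]) auto
    finally show ?thesis
      by (simp add: ennreal_le_iff)
  qed
  then have "gauged_cover d UNIV U (\<lambda>i. enn2real (diam_d d (U i))) A"
    using U(1) by (auto simp: gauged_cover_def)
  then show thesis
    using that U(3) by blast
qed

lemma hausdorff_measure_eq_0_iff_content:
  "hausdorff_measure d s A = 0 \<longleftrightarrow> (\<forall>\<delta>>0. hausdorff_content d s \<delta> A = 0)"
  unfolding hausdorff_measure_def by (auto simp: SUP_eq_iff bot_ennreal[symmetric])

lemma hausdorff_measure_eq_0I:
  assumes s: "0 < s"
    and content: "\<And>e. 0 < e \<Longrightarrow> cover_content_less d s e A"
  shows "hausdorff_measure d s A = 0"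
  unfolding hausdorff_measure_eq_0_iff_content
proof (intro allI impI)
  fix \<delta> :: real assume \<delta>: "0 < \<delta>"
  have "hausdorff_content d s \<delta> A \<le> 0 + ennreal e" if e: "0 < e" for e
  proof -
    have "0 < min e (\<delta> powr s)" using e \<delta> by simp
    then obtain U :: "nat \<Rightarrow> 'a set" and w where cover: "gauged_cover d UNIV U w A"
        and sum: "(\<Sum>i. ennreal (w i powr s)) < ennreal (min e (\<delta> powr s))"
      by (rule cover_content_lessE[OF content]) (rule that)
    have "w i \<le> \<delta>" for i
    proof -
      have "0 \<le> w i" using cover by (simp add: gauged_cover_def)
      moreover have "w i powr s < \<delta> powr s"
        using ennreal_suminf_lessD[OF sum, of i] by (simp add: ennreal_less_iff)
      ultimately show ?thesis
        using s \<delta> powr_mono2[of s \<delta> "w i"] by linarith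
    qed
    then have "hausdorff_content d s \<delta> A \<le> (\<Sum>i. ennreal (w i powr s))"
      using s by (intro hausdorff_content_le_gauged_cover[OF cover]) auto
    also have "\<dots> \<le> ennreal (min e (\<delta> powr s))"
      using sum by (rule less_imp_le)
    also have "\<dots> \<le> 0 + ennreal e"
      by (simp add: ennreal_leI)
    finally show ?thesis .
  qed
  then show "hausdorff_content d s \<delta> A = 0"
    using ennreal_le_epsilon[of 0 "hausdorff_content d s \<delta> A"] by simp
qed

lemma hausdorff_measure_eq_0D:
  assumes "hausdorff_measure d s A = 0" "0 < e"
  shows "cover_content_less d s e A"
proof -
  have "hausdorff_content d s 1 A < ennreal e"
    using assms by (simp add: hausdorff_measure_eq_0_iff_content)
  then show ?thesis
    by (rule hausdorff_content_less_gauged_coverE) (rule cover_content_lessI)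
qed

lemma suminf_ennreal_geometric_half:
  assumes "0 \<le> e"
  shows "(\<Sum>n. ennreal (e * (1/2) ^ Suc n)) = ennreal e"
  using assms sums_mult[OF power_half_series, of e] by (intro suminf_ennreal_eq) auto

lemma hausdorff_measure_eq_0_positive_gaugeE:
  assumes s: "0 < s" and null: "hausdorff_measure d s A = 0" and e: "0 < e"
  obtains U :: "nat \<Rightarrow> 'a set" and w
  where "gauged_cover d UNIV U w A" "\<And>i. 0 < w i" "(\<Sum>i. ennreal (w i powr s)) < ennreal e"
proof -
  obtain U :: "nat \<Rightarrow> 'a set" and v where cover: "gauged_cover d UNIV U v A"
      and sum: "(\<Sum>i. ennreal (v i powr s)) < ennreal (e / 2)"
    by (rule cover_content_lessE[OF hausdorff_measure_eq_0D[OF null half_gt_zero[OF e]]]) (rule that)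
  define w where "w i = (v i powr s + e / 2 * (1/2) ^ Suc i) powr (1 / s)" for i
  have "0 < v i powr s + e / 2 * (1/2) ^ Suc i" for i
    using e by (simp add: add_nonneg_pos)
  then have w_pos: "0 < w i" and w_powr: "w i powr s = v i powr s + e / 2 * (1/2) ^ Suc i" for i
    using s unfolding w_def by (simp_all add: powr_powr less_imp_le less_imp_neq[THEN not_sym])
  have "v i \<le> w i" for i
  proof (rule ccontr)
    assume "\<not> v i \<le> w i"
    then have "w i powr s < v i powr s"
      using w_pos[of i] s by (intro powr_less_mono2) auto
    moreover have "0 < e / 2 * (1/2) ^ Suc i" using e by simp
    ultimately show False
      unfolding w_powr by linarith
  qed
  then have "gauged_cover d UNIV U w A"
    using cover w_pos unfolding gauged_cover_def by (meson less_imp_le order_trans)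
  moreover have "(\<Sum>i. ennreal (w i powr s)) < ennreal e"
  proof -
    have "(\<Sum>i. ennreal (w i powr s))
        = (\<Sum>i. ennreal (v i powr s) + ennreal (e / 2 * (1/2) ^ Suc i))"
      unfolding w_powr using e by (intro suminf_cong ennreal_plus) auto
    also have "\<dots> = (\<Sum>i. ennreal (v i powr s)) + (\<Sum>i. ennreal (e / 2 * (1/2) ^ Suc i))"
      by (rule suminf_add[symmetric]) auto
    also have "\<dots> = (\<Sum>i. ennreal (v i powr s)) + ennreal (e / 2)"
      using e by (subst suminf_ennreal_geometric_half) auto
    also have "\<dots> < ennreal (e / 2) + ennreal (e / 2)"
      using sum by (simp add: ennreal_add_left_cancel_less add.commute)
    also have "\<dots> = ennreal e"
      using e by (simp flip: ennreal_plus)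
    finally show ?thesis .
  qed
  ultimately show thesis
    using w_pos that by blast
qed

lemma hausdorff_measure_eq_0_finite_ballsE:
  fixes A :: "'a::metric_space set"
  assumes s: "0 < s" and null: "hausdorff_measure dist s A = 0" and A: "compact A" and e: "0 < e"
  obtains J :: "nat set" and z \<rho>
  where "finite J" "A \<subseteq> (\<Union>j\<in>J. ball (z j) (\<rho> j))" "\<And>j. 0 < \<rho> j" "(\<Sum>j\<in>J. \<rho> j powr s) < e"
proof -
  have "0 < e / 2 powr s" using e by simp
  then obtain U :: "nat \<Rightarrow> 'a set" and w where cover: "gauged_cover dist UNIV U w A"
      and w_pos: "\<And>i. 0 < w i" and sum: "(\<Sum>i. ennreal (w i powr s)) < ennreal (e / 2 powr s)"
    by (rule hausdorff_measure_eq_0_positive_gaugeE[OF s null]) (rule that)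
  define z where "z i = (SOME x. x \<in> U i)" for i
  have "A \<subseteq> (\<Union>i. ball (z i) (2 * w i))"
  proof
    fix x assume "x \<in> A"
    then obtain i where i: "x \<in> U i"
      using cover by (auto simp: gauged_cover_def)
    then have "z i \<in> U i"
      unfolding z_def by (rule someI)
    then have "dist (z i) x \<le> w i"
      using cover i by (simp add: gauged_cover_def)
    then show "x \<in> (\<Union>i. ball (z i) (2 * w i))"
      using w_pos[of i] by (auto intro!: exI[of _ i])
  qed
  then obtain J where J: "finite J" "A \<subseteq> (\<Union>j\<in>J. ball (z j) (2 * w j))"
    using compactE_image[OF A, of UNIV "\<lambda>i. ball (z i) (2 * w i)"] by auto
  have "ennreal (\<Sum>j\<in>J. w j powr s) = (\<Sum>j\<in>J. ennreal (w j powr s))"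
    by (simp add: sum_ennreal)
  also have "\<dots> \<le> (\<Sum>j. ennreal (w j powr s))"
    using J(1) by (intro sum_le_suminf) auto
  also note sum
  finally have "(\<Sum>j\<in>J. w j powr s) < e / 2 powr s"
    by (simp add: ennreal_less_iff sum_nonneg)
  moreover have "(\<Sum>j\<in>J. (2 * w j) powr s) = 2 powr s * (\<Sum>j\<in>J. w j powr s)"
    using w_pos by (simp add: powr_mult less_imp_le sum_distrib_left)
  ultimately have "(\<Sum>j\<in>J. (2 * w j) powr s) < e"
    by (simp add: field_simps)
  then show thesis
    using that[OF J] w_pos by simp
qed

lemma hausdorff_measure_eq_0I_finite:
  assumes s: "0 < s"
    and covers: "\<And>e. 0 < e \<Longrightarrow> \<exists>(J :: 'i set) U w.
      finite J \<and> gauged_cover d J U w A \<and> (\<Sum>j\<in>J. w j powr s) < e"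
  shows "hausdorff_measure d s A = 0"
proof (rule hausdorff_measure_eq_0I[OF s])
  fix e :: real assume e: "0 < e"
  obtain J :: "'i set" and U w where J: "finite J" "gauged_cover d J U w A" "(\<Sum>j\<in>J. w j powr s) < e"
    using covers[OF e] by blast
  obtain h where h: "bij_betw h {..<card J} J"
    using ex_bij_betw_nat_finite[OF J(1)] by (auto simp: atLeast0LessThan)
  define U' where "U' i = (if i < card J then U (h i) else {})" for i
  define w' where "w' i = (if i < card J then w (h i) else 0)" for i
  have "A \<subseteq> (\<Union>j\<in>h ` {..<card J}. U j)"
    using J(2) bij_betw_imp_surj_on[OF h] by (simp add: gauged_cover_def)
  also have "\<dots> \<subseteq> (\<Union>i. U' i)"
    by (auto simp: U'_def split: if_splits)
  finally have "gauged_cover d UNIV U' w' A"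
    using J(2) bij_betwE[OF h] unfolding gauged_cover_def U'_def w'_def by auto
  moreover have "(\<Sum>i. ennreal (w' i powr s)) < ennreal e"
  proof -
    have "(\<Sum>i. ennreal (w' i powr s)) = (\<Sum>i<card J. ennreal (w' i powr s))"
      by (rule suminf_finite) (auto simp: w'_def)
    also have "\<dots> = ennreal (\<Sum>i<card J. w (h i) powr s)"
      by (simp add: w'_def sum_ennreal)
    also have "(\<Sum>i<card J. w (h i) powr s) = (\<Sum>j\<in>J. w j powr s)"
      by (rule sum.reindex_bij_betw[OF h])
    finally show ?thesis
      using J(3) by (simp add: ennreal_less_iff sum_nonneg)
  qed
  ultimately show "cover_content_less d s e A"
    by (rule cover_content_lessI)
qed

lemma hausdorff_measure_null_mono_exponent:
  assumes "0 \<le> s" "s \<le> t" "0 < t" and null: "hausdorff_measure d s A = 0"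
  shows "hausdorff_measure d t A = 0"
proof (rule hausdorff_measure_eq_0I[OF \<open>0 < t\<close>])
  fix e :: real assume "0 < e"
  then have "0 < min e 1" by simp
  then obtain U :: "nat \<Rightarrow> 'a set" and w where cover: "gauged_cover d UNIV U w A"
      and sum: "(\<Sum>i. ennreal (w i powr s)) < ennreal (min e 1)"
    by (rule cover_content_lessE[OF hausdorff_measure_eq_0D[OF null]]) (rule that)
  have "w i powr t \<le> w i powr s" for i
  proof (rule powr_mono')
    have "w i powr s < 1"
      using ennreal_suminf_lessD[OF sum, of i] by (simp add: ennreal_less_iff)
    then show "w i \<le> 1"
      using \<open>0 \<le> s\<close> ge_one_powr_ge_zero[of "w i" s] by linarith
  qed (use assms cover in \<open>auto simp: gauged_cover_def\<close>)
  then have "(\<Sum>i. ennreal (w i powr t)) \<le> (\<Sum>i. ennreal (w i powr s))"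
    by (intro suminf_le ennreal_leI) auto
  also have "\<dots> < ennreal e"
    using sum by (rule less_le_trans) (simp add: ennreal_leI)
  finally show "cover_content_less d t e A"
    by (rule cover_content_lessI[OF cover])
qed

lemma hausdorff_measure_null_subset:
  assumes "0 < s" "A \<subseteq> B" and null: "hausdorff_measure d s B = 0"
  shows "hausdorff_measure d s A = 0"
proof (rule hausdorff_measure_eq_0I[OF \<open>0 < s\<close>])
  fix e :: real assume "0 < e"
  then have "cover_content_less d s e B"
    by (rule hausdorff_measure_eq_0D[OF null])
  then show "cover_content_less d s e A"
    unfolding cover_content_less_def using gauged_cover_subset[OF _ \<open>A \<subseteq> B\<close>] by meson
qed

lemma hausdorff_measure_null_empty: "0 < s \<Longrightarrow> hausdorff_measure d s {} = 0"
  by (rule hausdorff_measure_eq_0I_finite)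
    (auto simp: gauged_cover_def intro!: exI[of _ "{} :: nat set"])

lemma gauged_cover_UN:
  fixes U :: "nat \<Rightarrow> nat \<Rightarrow> 'a set"
  assumes "\<And>n. gauged_cover d UNIV (U n) (w n) (A n)"
  shows "gauged_cover d UNIV (\<lambda>k. case_prod U (prod_decode k)) (\<lambda>k. case_prod w (prod_decode k))
    (\<Union>n. A n)"
proof -
  have "A n \<subseteq> (\<Union>i. U n i)" for n
    using assms[of n] by (simp add: gauged_cover_def)
  then have "(\<Union>n. A n) \<subseteq> (\<Union>n. \<Union>i. U n i)"
    by (intro UN_mono) auto
  also have "\<dots> \<subseteq> (\<Union>k. case_prod U (prod_decode k))"
  proof clarify
    fix x n i assume "x \<in> U n i"
    then show "x \<in> (\<Union>k. case_prod U (prod_decode k))"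
      by (intro UN_I[of "prod_encode (n, i)"]) simp_all
  qed
  finally have "(\<Union>n. A n) \<subseteq> (\<Union>k. case_prod U (prod_decode k))" .
  moreover have "0 \<le> w n i \<and> (\<forall>x\<in>U n i. \<forall>y\<in>U n i. d x y \<le> w n i)" for n i
    using assms[of n] by (simp add: gauged_cover_def)
  ultimately show ?thesis
    by (simp add: gauged_cover_def split_beta)
qed

lemma hausdorff_measure_null_UN:
  fixes A :: "nat \<Rightarrow> 'a set"
  assumes s: "0 < s" and null: "\<And>n. hausdorff_measure d s (A n) = 0"
  shows "hausdorff_measure d s (\<Union>n. A n) = 0"
proof (rule hausdorff_measure_eq_0I[OF s])
  fix e :: real assume e: "0 < e"
  have "cover_content_less d s (e / 2 * (1/2) ^ Suc n) (A n)" for n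
    by (rule hausdorff_measure_eq_0D[OF null]) (use e in simp)
  then obtain U :: "nat \<Rightarrow> nat \<Rightarrow> 'a set" and w where
    covers: "\<And>n. gauged_cover d UNIV (U n) (w n) (A n)" and
    sums: "\<And>n. (\<Sum>i. ennreal (w n i powr s)) < ennreal (e / 2 * (1/2) ^ Suc n)"
    unfolding cover_content_less_def by metis
  have "(\<Sum>k. ennreal (case_prod w (prod_decode k) powr s)) = (\<Sum>n. \<Sum>i. ennreal (w n i powr s))"
    unfolding split_beta
    by (subst suminf_ennreal_2dimen[symmetric, where f = "\<lambda>p. ennreal (w (fst p) (snd p) powr s)"])
      auto
  also have "\<dots> \<le> (\<Sum>n. ennreal (e / 2 * (1/2) ^ Suc n))"
    by (intro suminf_le less_imp_le[OF sums]) auto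
  also have "\<dots> = ennreal (e / 2)"
    using e by (intro suminf_ennreal_geometric_half) simp
  also have "\<dots> < ennreal e"
    using e by (simp add: ennreal_less_iff)
  finally show "cover_content_less d s e (\<Union>n. A n)"
    by (rule cover_content_lessI[OF gauged_cover_UN[where w = w, OF covers]])
qed

lemma hausdorff_measure_null_Un:
  assumes "0 < s" "hausdorff_measure d s A = 0" "hausdorff_measure d s B = 0"
  shows "hausdorff_measure d s (A \<union> B) = 0"
proof -
  have "hausdorff_measure d s (\<Union>n::nat. if n = 0 then A else B) = 0"
    using assms by (intro hausdorff_measure_null_UN) auto
  moreover have "(\<Union>n::nat. if n = 0 then A else B) = A \<union> B"
    by (auto split: if_splits)
  ultimately show ?thesis by simp
qed

lemma hausdorff_measure_null_Lipschitz_image: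
  assumes s: "0 < s" and null: "hausdorff_measure d s A = 0" and L: "0 \<le> L"
    and Lipschitz: "\<And>x y. x \<in> A \<Longrightarrow> y \<in> A \<Longrightarrow> d' (\<phi> x) (\<phi> y) \<le> L * d x y"
  shows "hausdorff_measure d' s (\<phi> ` A) = 0"
proof (rule hausdorff_measure_eq_0I[OF s])
  fix e :: real assume e: "0 < e"
  have L1: "0 < (L + 1) powr s" using L by simp
  obtain U :: "nat \<Rightarrow> 'a set" and w where cover: "gauged_cover d UNIV U w A"
      and sum: "(\<Sum>i. ennreal (w i powr s)) < ennreal (e / (L + 1) powr s)"
    by (rule cover_content_lessE[OF hausdorff_measure_eq_0D[OF null divide_pos_pos[OF e L1]]])
      (rule that)
  have "d' (\<phi> x) (\<phi> y) \<le> (L + 1) * w i" if "x \<in> U i \<inter> A" "y \<in> U i \<inter> A" for x y i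
  proof -
    have "d x y \<le> w i" "0 \<le> w i"
      using cover that by (auto simp: gauged_cover_def)
    then have "L * d x y \<le> (L + 1) * w i"
      using mult_left_mono[OF _ L, of "d x y" "w i"] by (simp add: algebra_simps)
    then show ?thesis
      using Lipschitz[of x y] that by simp
  qed
  moreover have "\<phi> ` A \<subseteq> (\<Union>i. \<phi> ` (U i \<inter> A))"
    using cover unfolding gauged_cover_def by blast
  ultimately have "gauged_cover d' UNIV (\<lambda>i. \<phi> ` (U i \<inter> A)) (\<lambda>i. (L + 1) * w i) (\<phi> ` A)"
    using cover L unfolding gauged_cover_def by auto
  moreover have "(\<Sum>i. ennreal (((L + 1) * w i) powr s)) < ennreal e"
  proof -
    have "(\<Sum>i. ennreal (((L + 1) * w i) powr s))
        = ennreal ((L + 1) powr s) * (\<Sum>i. ennreal (w i powr s))"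
      using cover L by (simp add: gauged_cover_def powr_mult ennreal_mult)
    also have "\<dots> < ennreal ((L + 1) powr s) * ennreal (e / (L + 1) powr s)"
      using sum L1 by (intro ennreal_mult_strict_left_mono) auto
    also have "\<dots> = ennreal e"
      using L1 e by (simp flip: ennreal_mult)
    finally show ?thesis .
  qed
  ultimately show "cover_content_less d' s e (\<phi> ` A)"
    by (rule cover_content_lessI)
qed

lemma hausdorff_dim_le_if_null:
  "0 \<le> s \<Longrightarrow> hausdorff_measure d s A = 0 \<Longrightarrow> hausdorff_dim d A \<le> ereal s"
  unfolding hausdorff_dim_def by (auto intro: Inf_lower)

lemma hausdorff_dim_nonneg: "0 \<le> hausdorff_dim d A"
  unfolding hausdorff_dim_def by (auto intro: Inf_greatest)

lemma hausdorff_measure_null_if_dim_less: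
  assumes "hausdorff_dim d A < ereal t"
  shows "hausdorff_measure d t A = 0"
proof -
  obtain s where "0 \<le> s" "s < t" "hausdorff_measure d s A = 0"
    using assms unfolding hausdorff_dim_def Inf_less_iff by auto
  then show ?thesis
    using hausdorff_measure_null_mono_exponent[of s t d A] by simp
qed

lemma hausdorff_dim_le_dimI:
  assumes null: "\<And>t. 0 < t \<Longrightarrow> hausdorff_measure d t A = 0 \<Longrightarrow> hausdorff_measure d' t B = 0"
  shows "hausdorff_dim d' B \<le> hausdorff_dim d A"
proof (rule ccontr)
  assume "\<not> ?thesis"
  then obtain t where t: "hausdorff_dim d A < ereal t" "ereal t < hausdorff_dim d' B"
    using ereal_dense2 by (auto simp: not_le)
  then have "0 < t"
    using hausdorff_dim_nonneg[of d A] by (metis ereal_less(2) le_less_trans)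
  then have "hausdorff_dim d' B \<le> ereal t"
    using null hausdorff_measure_null_if_dim_less[OF t(1)] by (intro hausdorff_dim_le_if_null) auto
  then show False
    using t(2) by simp
qed

lemma hausdorff_dim_mono: "A \<subseteq> B \<Longrightarrow> hausdorff_dim d A \<le> hausdorff_dim d B"
  by (intro hausdorff_dim_le_dimI) (auto intro: hausdorff_measure_null_subset)

lemma hausdorff_dim_Lipschitz_image:
  assumes "0 \<le> L" "\<And>x y. x \<in> A \<Longrightarrow> y \<in> A \<Longrightarrow> d' (\<phi> x) (\<phi> y) \<le> L * d x y"
  shows "hausdorff_dim d' (\<phi> ` A) \<le> hausdorff_dim d A"
  using assms by (intro hausdorff_dim_le_dimI hausdorff_measure_null_Lipschitz_image[of _ _ _ L]) auto

lemma hausdorff_dim_Un_null: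
  assumes "0 < s" "ereal s \<le> hausdorff_dim d A" "hausdorff_measure d s N = 0"
  shows "hausdorff_dim d (A \<union> N) = hausdorff_dim d A"
proof (rule antisym[OF hausdorff_dim_le_dimI])
  fix t assume t: "0 < t" "hausdorff_measure d t A = 0"
  then have "s \<le> t"
    using order_trans[OF assms(2) hausdorff_dim_le_if_null] by simp
  then have "hausdorff_measure d t N = 0"
    using assms t(1) by (intro hausdorff_measure_null_mono_exponent[of s t]) auto
  then show "hausdorff_measure d t (A \<union> N) = 0"
    using t by (intro hausdorff_measure_null_Un)
qed (simp add: hausdorff_dim_mono)

lemma hausdorff_dim_empty_le: "hausdorff_dim d {} \<le> ereal s" if "0 < s"
  using that by (intro hausdorff_dim_le_if_null hausdorff_measure_null_empty) auto

subsection \<open>Exhausted sequences in nets of cells\<close>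

locale cell_net =
  fixes X :: "'a set" and code :: "nat \<Rightarrow> 'a \<Rightarrow> 'c" and r :: "nat \<Rightarrow> real"
  assumes finite_codes: "finite (code n ` X)"
    and code_refines: "x \<in> X \<Longrightarrow> y \<in> X \<Longrightarrow> code (Suc n) x = code (Suc n) y \<Longrightarrow> code n x = code n y"
    and r_pos: "0 < r n"
    and r_tendsto_0: "r \<longlonglongrightarrow> 0"
begin

definition cell :: "nat \<times> 'c \<Rightarrow> 'a set" where
  "cell q = {x \<in> X. code (fst q) x = snd q}"

definition weight :: "(nat \<times> 'c) set \<Rightarrow> real" where
  "weight S = (\<Sum>q\<in>S. r (fst q))"

definition deep_cover :: "nat \<Rightarrow> (nat \<times> 'c) set \<Rightarrow> 'a set \<Rightarrow> bool" where
  "deep_cover n S A \<longleftrightarrow> finite S \<and> (\<forall>q\<in>S. n \<le> fst q) \<and> A \<subseteq> \<Union> (cell ` S)"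

definition heavy :: "real \<Rightarrow> 'a set \<Rightarrow> bool" where
  "heavy c A \<longleftrightarrow> (\<forall>S. finite S \<longrightarrow> A \<subseteq> \<Union> (cell ` S) \<longrightarrow> c \<le> weight S)"

text \<open>An exhausted sequence arises by discarding cells one after the other as long as the content of
  the remaining set stays at least \<open>c\<close>. No cell that is left is superfluous, so every cover can be
  refined to deeper levels at arbitrarily small cost.\<close>

definition exhausted :: "real \<Rightarrow> (nat \<Rightarrow> 'a set) \<Rightarrow> bool" where
  "exhausted c A \<longleftrightarrow> decseq A \<and> A 0 \<subseteq> X \<and> (\<forall>n. heavy c (A n)) \<and>
     (\<forall>q. \<exists>n. A n \<inter> cell q = {} \<or> \<not> heavy c (A n - cell q))"

lemma mem_cell_code: "x \<in> X \<Longrightarrow> x \<in> cell (n, code n x)"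
  by (simp add: cell_def)

lemma heavyD: "heavy c A \<Longrightarrow> finite S \<Longrightarrow> A \<subseteq> \<Union> (cell ` S) \<Longrightarrow> c \<le> weight S"
  by (simp add: heavy_def)

lemma weight_insert_le: "finite S \<Longrightarrow> weight (insert q S) \<le> r (fst q) + weight S"
  using r_pos by (simp add: weight_def sum.insert_if less_imp_le)

lemma weight_UN_le:
  assumes "finite J" "\<And>j. j \<in> J \<Longrightarrow> finite (S j)"
  shows "weight (\<Union>j\<in>J. S j) \<le> (\<Sum>j\<in>J. weight (S j))"
  using assms
proof (induction J rule: finite_induct)
  case (insert j J)
  then have "weight (S j \<union> (\<Union>j\<in>J. S j)) \<le> weight (S j) + weight (\<Union>j\<in>J. S j)"
    using r_pos by (simp add: weight_def sum_Un sum_nonneg less_imp_le)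
  then show ?case
    using insert by simp
qed (simp add: weight_def)

lemma deep_cover_mono:
  "deep_cover n S B \<Longrightarrow> A \<subseteq> B \<Longrightarrow> m \<le> n \<Longrightarrow> deep_cover m S A"
  by (fastforce simp: deep_cover_def)

lemma deep_cover_UN:
  assumes "finite J" "\<And>j. j \<in> J \<Longrightarrow> deep_cover n (S j) (B j)"
  shows "deep_cover n (\<Union>j\<in>J. S j) (\<Union>j\<in>J. B j)"
proof -
  have "finite (S j)" "\<forall>q\<in>S j. n \<le> fst q" "B j \<subseteq> \<Union> (cell ` S j)" if "j \<in> J" for j
    using assms(2)[OF that] by (simp_all add: deep_cover_def)
  then show ?thesis
    using \<open>finite J\<close> UN_mono[of J J B "\<lambda>j. \<Union> (cell ` S j)"]
    by (simp add: deep_cover_def UN_UN_flatten)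
qed

lemma code_eq_mono:
  assumes "x \<in> X" "y \<in> X" and "k \<le> m" "code m x = code m y"
  shows "code k x = code k y"
  using assms(3,4)
proof (induction m rule: dec_induct)
  case (step m)
  then show ?case
    using code_refines[OF assms(1,2)] by blast
qed

lemma cell_nested:
  assumes "fst q \<le> fst p" "cell p \<inter> cell q \<noteq> {}"
  shows "cell p \<subseteq> cell q"
proof
  obtain y where y: "y \<in> cell p" "y \<in> cell q"
    using assms(2) by blast
  fix x assume "x \<in> cell p"
  then show "x \<in> cell q"
    using code_eq_mono[of x y "fst q" "fst p"] y assms(1) by (simp add: cell_def)
qed

lemma exhausted_sequence_exists:
  assumes "heavy c X"
  obtains A where "exhausted c A"
proof -
  define Q where "Q = (SIGMA n : UNIV. code n ` X)"
  have "countable Q"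
    unfolding Q_def by (rule countable_SIGMA) (auto intro: countable_finite finite_codes)
  define A where "A = rec_nat X (\<lambda>n B.
    if heavy c (B - cell (from_nat_into Q n)) then B - cell (from_nat_into Q n) else B)"
  have A_0: "A 0 = X" and A_Suc: "A (Suc n) =
      (if heavy c (A n - cell (from_nat_into Q n)) then A n - cell (from_nat_into Q n) else A n)" for n
    by (simp_all add: A_def)
  have "heavy c (A n)" for n
    by (induction n) (use assms in \<open>auto simp: A_0 A_Suc\<close>)
  moreover have "\<exists>n. A n \<inter> cell q = {} \<or> \<not> heavy c (A n - cell q)" for q
  proof (cases "q \<in> Q")
    case True
    then obtain n where "from_nat_into Q n = q"
      using from_nat_into_surj[OF \<open>countable Q\<close>] by blast
    then have "A (Suc n) \<inter> cell q = {} \<or> \<not> heavy c (A n - cell q)"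
      by (auto simp: A_Suc)
    then show ?thesis by blast
  next
    case False
    then have "cell q = {}"
      by (cases q) (auto simp: Q_def cell_def)
    then show ?thesis by simp
  qed
  moreover have "decseq A"
    by (rule decseq_SucI) (auto simp: A_Suc)
  ultimately show thesis
    using that[of A] by (simp add: exhausted_def A_0)
qed

lemma exhausted_mono: "exhausted c A \<Longrightarrow> m \<le> n \<Longrightarrow> A n \<subseteq> A m"
  by (simp add: exhausted_def decseq_def)

lemma exhausted_subset: "exhausted c A \<Longrightarrow> A n \<subseteq> X"
  using exhausted_mono[of c A 0 n] by (auto simp: exhausted_def)

lemma exhausted_heavy: "exhausted c A \<Longrightarrow> heavy c (A n)"
  by (simp add: exhausted_def)

lemma persistent_subcell_exists:
  assumes "exhausted c A" and persistent: "\<And>n. A n \<inter> cell q \<noteq> {}" and "fst q \<le> m"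
  obtains p where "fst p = m" "cell p \<subseteq> cell q" "\<And>n. A n \<inter> cell p \<noteq> {}"
proof -
  have "\<exists>v\<in>code m ` X. \<forall>n. A n \<inter> cell q \<inter> cell (m, v) \<noteq> {}"
  proof (rule ccontr)
    assume "\<not> ?thesis"
    then have "\<forall>v\<in>code m ` X. \<exists>k. A k \<inter> cell q \<inter> cell (m, v) = {}"
      by blast
    then have "\<forall>v\<in>code m ` X. \<forall>\<^sub>F n in sequentially. A n \<inter> cell q \<inter> cell (m, v) = {}"
      using exhausted_mono[OF assms(1)] unfolding eventually_sequentially by blast
    then have "\<forall>\<^sub>F n in sequentially. \<forall>v\<in>code m ` X. A n \<inter> cell q \<inter> cell (m, v) = {}"
      by (rule eventually_ball_finite[OF finite_codes])
    then obtain n where n: "\<And>v. v \<in> code m ` X \<Longrightarrow> A n \<inter> cell q \<inter> cell (m, v) = {}"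
      unfolding eventually_sequentially by blast
    obtain x where "x \<in> A n" "x \<in> cell q" "x \<in> X"
      using persistent[of n] exhausted_subset[OF assms(1)] by blast
    then show False
      using n[of "code m x"] mem_cell_code[of x m] by blast
  qed
  then obtain v where v: "\<And>n. A n \<inter> cell q \<inter> cell (m, v) \<noteq> {}"
    by blast
  then have "cell (m, v) \<subseteq> cell q"
    using v[of 0] \<open>fst q \<le> m\<close> by (intro cell_nested) auto
  then show thesis
    using that[of "(m, v)"] v by fastforce
qed

text \<open>A cover of \<open>A n - cell p\<close> of weight less than \<open>c\<close> cannot contain a cell above \<open>p\<close>, and
  exchanging its cells inside \<open>cell q\<close> for \<open>q\<close> itself would make it a cover of \<open>A n\<close>.\<close>

lemma light_cover_of_cell_remainder:
  assumes A: "exhausted c A" and pq: "cell p \<subseteq> cell q" "cell p \<noteq> {}" "\<not> heavy c (A n - cell p)"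
  obtains S where "deep_cover (Suc (fst q)) S (A n \<inter> cell q - cell p)" "weight S \<le> r (fst q)"
proof -
  obtain S where S: "finite S" "A n - cell p \<subseteq> \<Union> (cell ` S)" "weight S < c"
    using pq(3) by (auto simp: heavy_def not_le)
  define inner where "inner = {s \<in> S. fst q < fst s \<and> cell s \<inter> cell q \<noteq> {}}"
  have inner: "finite inner" "inner \<subseteq> S" "\<And>s. s \<in> inner \<Longrightarrow> cell s \<subseteq> cell q"
      "\<And>s. s \<in> inner \<Longrightarrow> fst q < fst s"
    using S(1) cell_nested unfolding inner_def by (auto simp: less_imp_le)
  have "A n \<inter> cell q - cell p \<subseteq> \<Union> (cell ` inner)"
  proof
    fix x assume x: "x \<in> A n \<inter> cell q - cell p"
    then obtain s where s: "s \<in> S" "x \<in> cell s"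
      using S(2) by blast
    have "fst q < fst s"
    proof (rule ccontr)
      assume "\<not> fst q < fst s"
      then have "cell q \<subseteq> cell s"
        using s x by (intro cell_nested) auto
      then have "A n \<subseteq> \<Union> (cell ` S)"
        using S(2) s(1) pq(1) by blast
      then show False
        using heavyD[OF exhausted_heavy[OF A] S(1)] S(3) by simp
    qed
    then show "x \<in> \<Union> (cell ` inner)"
      using s x unfolding inner_def by blast
  qed
  moreover have "weight inner \<le> r (fst q)"
  proof -
    have "A n \<subseteq> \<Union> (cell ` insert q (S - inner))"
      using S(2) inner(3) pq(1) by blast
    then have "c \<le> weight (insert q (S - inner))"
      using S(1) by (intro heavyD[OF exhausted_heavy[OF A]]) auto
    also have "\<dots> \<le> r (fst q) + weight (S - inner)"
      using S(1) by (intro weight_insert_le) auto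
    also have "weight (S - inner) = weight S - weight inner"
      unfolding weight_def using S(1) inner(2) by (rule sum_diff)
    finally show ?thesis
      using S(3) by simp
  qed
  ultimately show thesis
    using that[of inner] inner(1,4) by (simp add: deep_cover_def Suc_le_eq)
qed

lemma cell_refinement:
  assumes A: "exhausted c A" and \<epsilon>: "0 < \<epsilon>"
  shows "\<exists>n S. deep_cover (Suc (fst q)) S (A n \<inter> cell q) \<and> weight S \<le> r (fst q) + \<epsilon>"
proof (cases "\<exists>n. A n \<inter> cell q = {}")
  case True
  then show ?thesis
    using \<epsilon> r_pos[of "fst q"] by (force simp: deep_cover_def weight_def intro!: exI[of _ "{}"])
next
  case False
  have "\<forall>\<^sub>F m in sequentially. r m < \<epsilon> \<and> fst q < m"
    using order_tendstoD(2)[OF r_tendsto_0 \<epsilon>] eventually_gt_at_top by (rule eventually_conj)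
  then obtain m where m: "r m < \<epsilon>" "fst q < m"
    unfolding eventually_sequentially by blast
  obtain p where p: "fst p = m" "cell p \<subseteq> cell q" "\<And>n. A n \<inter> cell p \<noteq> {}"
    using persistent_subcell_exists[OF A, of q m] False m(2) by (metis less_imp_le)
  obtain n where "\<not> heavy c (A n - cell p)"
    using A p(3) unfolding exhausted_def by blast
  then obtain S where S: "deep_cover (Suc (fst q)) S (A n \<inter> cell q - cell p)" "weight S \<le> r (fst q)"
    using light_cover_of_cell_remainder[OF A p(2)] p(3)[of 0] by blast
  then have "weight (insert p S) \<le> r (fst q) + \<epsilon>"
    using weight_insert_le[of S p] m(1) p(1) by (simp add: deep_cover_def)
  moreover have "deep_cover (Suc (fst q)) (insert p S) (A n \<inter> cell q)"
    using S(1) p(1) m(2) by (auto simp: deep_cover_def)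
  ultimately show ?thesis by blast
qed

lemma cover_refinement:
  assumes A: "exhausted c A" and \<epsilon>: "0 < \<epsilon>" and S: "deep_cover n S (A m)"
  shows "\<exists>m' S'. deep_cover (Suc n) S' (A m') \<and> weight S' \<le> weight S + \<epsilon>"
proof -
  have finite_S: "finite S"
    using S by (simp add: deep_cover_def)
  define \<epsilon>' where "\<epsilon>' = \<epsilon> / (real (card S) + 1)"
  have "0 < \<epsilon>'"
    unfolding \<epsilon>'_def using \<epsilon> by (intro divide_pos_pos) auto
  then obtain M R where R: "\<And>q. deep_cover (Suc (fst q)) (R q) (A (M q) \<inter> cell q)"
      "\<And>q. weight (R q) \<le> r (fst q) + \<epsilon>'"
    using cell_refinement[OF A] by metis
  define m' where "m' = Max (insert m (M ` S))"
  have m': "m \<le> m'" "\<And>q. q \<in> S \<Longrightarrow> M q \<le> m'"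
    using finite_S by (auto simp: m'_def)
  have "A m' \<subseteq> (\<Union>q\<in>S. A (M q) \<inter> cell q)"
  proof
    fix x assume x: "x \<in> A m'"
    then obtain q where "q \<in> S" "x \<in> cell q"
      using S exhausted_mono[OF A m'(1)] unfolding deep_cover_def by blast
    then show "x \<in> (\<Union>q\<in>S. A (M q) \<inter> cell q)"
      using x exhausted_mono[OF A m'(2)] by blast
  qed
  moreover have "deep_cover (Suc n) (R q) (A (M q) \<inter> cell q)" if "q \<in> S" for q
    using R(1)[of q] S that by (intro deep_cover_mono[OF R(1)]) (auto simp: deep_cover_def)
  ultimately have "deep_cover (Suc n) (\<Union>q\<in>S. R q) (A m')"
    by (intro deep_cover_mono[OF deep_cover_UN[OF finite_S] _ order_refl])
  moreover have "weight (\<Union>q\<in>S. R q) \<le> weight S + \<epsilon>"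
  proof -
    have "weight (\<Union>q\<in>S. R q) \<le> (\<Sum>q\<in>S. weight (R q))"
      using finite_S R(1) by (intro weight_UN_le) (auto simp: deep_cover_def)
    also have "\<dots> \<le> (\<Sum>q\<in>S. r (fst q) + \<epsilon>')"
      by (intro sum_mono R(2))
    also have "\<dots> = weight S + real (card S) * \<epsilon>'"
      by (simp add: weight_def sum.distrib)
    also have "real (card S) * \<epsilon>' \<le> \<epsilon>"
      using \<epsilon> by (simp add: \<epsilon>'_def field_simps)
    finally show ?thesis by simp
  qed
  ultimately show ?thesis by blast
qed

lemma deep_covers_of_bounded_weight:
  assumes A: "exhausted c A"
  obtains W where "\<And>n. \<exists>m S. deep_cover n S (A m) \<and> weight S \<le> W"
proof
  define W where "W = weight (Pair 0 ` code 0 ` X)"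
  have "\<exists>m S. deep_cover n S (A m) \<and> weight S \<le> W + 1 - (1/2) ^ n" for n
  proof (induction n)
    case 0
    have "A 0 \<subseteq> \<Union> (cell ` Pair 0 ` code 0 ` X)"
      using exhausted_subset[OF A, of 0] mem_cell_code by blast
    then have "deep_cover 0 (Pair 0 ` code 0 ` X) (A 0)"
      using finite_codes by (simp add: deep_cover_def)
    then show ?case
      by (intro exI[of _ 0] exI[of _ "Pair 0 ` code 0 ` X"]) (simp add: W_def)
  next
    case (Suc n)
    then obtain m S where S: "deep_cover n S (A m)" "weight S \<le> W + 1 - (1/2) ^ n"
      by blast
    then obtain m' S' where S': "deep_cover (Suc n) S' (A m')" "weight S' \<le> weight S + (1/2) ^ Suc n"
      using cover_refinement[OF A, of "(1/2) ^ Suc n" n S m] by auto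
    moreover have "weight S' \<le> W + 1 - (1/2) ^ Suc n"
      using S(2) S'(2) by simp
    ultimately show ?case by blast
  qed
  moreover have "W + 1 - (1/2) ^ n \<le> W + 1" for n
    by simp
  ultimately show "\<exists>m S. deep_cover n S (A m) \<and> weight S \<le> W + 1" for n
    by (meson order_trans)
qed

end

subsection \<open>Dyadic nets in Euclidean spaces\<close>

definition dyadic_code :: "nat \<Rightarrow> 'a::euclidean_space \<Rightarrow> 'a \<Rightarrow> int" where
  "dyadic_code n x = (\<lambda>i\<in>Basis. \<lfloor>2 ^ n * (x \<bullet> i)\<rfloor>)"

lemma dyadic_code_in_PiE_iff:
  "dyadic_code n x \<in> Pi\<^sub>E Basis B \<longleftrightarrow> (\<forall>i\<in>Basis. \<lfloor>2 ^ n * (x \<bullet> i)\<rfloor> \<in> B i)"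
  by (auto simp: dyadic_code_def PiE_iff)

lemma dyadic_code_eq_iff:
  "dyadic_code n x = dyadic_code n y \<longleftrightarrow> (\<forall>i\<in>Basis. \<lfloor>2 ^ n * (x \<bullet> i)\<rfloor> = \<lfloor>2 ^ n * (y \<bullet> i)\<rfloor>)"
  by (auto simp: dyadic_code_def fun_eq_iff restrict_apply)

lemma finite_dyadic_codes:
  fixes X :: "'a::euclidean_space set"
  assumes "bounded X"
  shows "finite (dyadic_code n ` X)"
proof -
  obtain M where M: "\<And>x. x \<in> X \<Longrightarrow> norm x \<le> M"
    using assms by (auto simp: bounded_iff)
  have "dyadic_code n x \<in> Pi\<^sub>E Basis (\<lambda>_. {\<lfloor>- (2 ^ n * M)\<rfloor>..\<lfloor>2 ^ n * M\<rfloor>})" if "x \<in> X" for x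
    unfolding dyadic_code_in_PiE_iff
  proof
    fix i :: 'a assume "i \<in> Basis"
    then have "\<bar>x \<bullet> i\<bar> \<le> M"
      using Basis_le_norm[of i x] M[OF that] by linarith
    then have "2 ^ n * \<bar>x \<bullet> i\<bar> \<le> 2 ^ n * M"
      by simp
    then have "\<bar>2 ^ n * (x \<bullet> i)\<bar> \<le> 2 ^ n * M"
      by (simp add: abs_mult)
    then show "\<lfloor>2 ^ n * (x \<bullet> i)\<rfloor> \<in> {\<lfloor>- (2 ^ n * M)\<rfloor>..\<lfloor>2 ^ n * M\<rfloor>}"
      unfolding atLeastAtMost_iff by (intro conjI floor_mono) linarith+
  qed
  then have "dyadic_code n ` X \<subseteq> Pi\<^sub>E Basis (\<lambda>_. {\<lfloor>- (2 ^ n * M)\<rfloor>..\<lfloor>2 ^ n * M\<rfloor>})"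
    by blast
  then show ?thesis
    by (rule finite_subset) (auto intro: finite_PiE)
qed

lemma dyadic_code_refines:
  assumes "dyadic_code (Suc n) x = dyadic_code (Suc n) y"
  shows "dyadic_code n x = dyadic_code n y"
proof -
  have "\<lfloor>2 ^ n * t\<rfloor> = \<lfloor>2 ^ Suc n * t\<rfloor> div 2" for t :: real
    using floor_divide_real_eq_div[of 2 "2 ^ Suc n * t"] by simp
  then show ?thesis
    using assms by (simp add: dyadic_code_eq_iff)
qed

lemma dist_le_if_dyadic_code_eq:
  fixes x y :: "'a::euclidean_space"
  assumes "dyadic_code n x = dyadic_code n y"
  shows "dist x y \<le> DIM('a) * (1/2) ^ n"
proof -
  have "\<bar>(x - y) \<bullet> i\<bar> \<le> (1/2) ^ n" if "i \<in> Basis" for i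
  proof -
    have "\<lfloor>2 ^ n * (x \<bullet> i)\<rfloor> = \<lfloor>2 ^ n * (y \<bullet> i)\<rfloor>"
      using assms that by (simp add: dyadic_code_eq_iff)
    then have "\<bar>2 ^ n * (x \<bullet> i) - 2 ^ n * (y \<bullet> i)\<bar> \<le> 1"
      by linarith
    then have "2 ^ n * \<bar>(x - y) \<bullet> i\<bar> \<le> 1"
      by (simp add: abs_mult inner_diff_left flip: right_diff_distrib)
    then show ?thesis
      by (simp add: field_simps)
  qed
  then have "(\<Sum>i\<in>Basis. \<bar>(x - y) \<bullet> i\<bar>) \<le> DIM('a) * (1/2) ^ n"
    by (intro sum_bounded_above)
  then show ?thesis
    using norm_le_l1[of "x - y"] by (simp add: dist_norm)
qed

lemma dyadic_codes_ball:
  fixes z :: "'a::euclidean_space"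
  assumes "\<rho> \<le> (1/2) ^ n"
  shows "dyadic_code n ` ball z \<rho> \<subseteq>
    Pi\<^sub>E Basis (\<lambda>i. {\<lfloor>2 ^ n * (z \<bullet> i)\<rfloor> - 1..\<lfloor>2 ^ n * (z \<bullet> i)\<rfloor> + 1})"
proof clarify
  fix x assume x: "x \<in> ball z \<rho>"
  have "\<lfloor>2 ^ n * (x \<bullet> i)\<rfloor> \<in> {\<lfloor>2 ^ n * (z \<bullet> i)\<rfloor> - 1..\<lfloor>2 ^ n * (z \<bullet> i)\<rfloor> + 1}" if "i \<in> Basis" for i
  proof -
    have "\<bar>(z - x) \<bullet> i\<bar> \<le> (1/2) ^ n"
      using Basis_le_norm[OF that, of "z - x"] x assms by (simp add: dist_norm)
    then have "2 ^ n * \<bar>(z - x) \<bullet> i\<bar> \<le> 1"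
      by (simp add: field_simps)
    then have "\<bar>2 ^ n * (z \<bullet> i) - 2 ^ n * (x \<bullet> i)\<bar> \<le> 1"
      by (simp add: abs_mult inner_diff_left flip: right_diff_distrib)
    then show ?thesis
      unfolding atLeastAtMost_iff by linarith
  qed
  then show "dyadic_code n x \<in>
      Pi\<^sub>E Basis (\<lambda>i. {\<lfloor>2 ^ n * (z \<bullet> i)\<rfloor> - 1..\<lfloor>2 ^ n * (z \<bullet> i)\<rfloor> + 1})"
    by (simp add: dyadic_code_in_PiE_iff)
qed

lemma between_half_powers:
  fixes \<rho> :: real
  assumes "0 < \<rho>" "\<rho> \<le> 1"
  obtains k where "(1/2) ^ Suc k < \<rho>" "\<rho> \<le> (1/2) ^ k"
proof -
  obtain n where "(1/2) ^ n < \<rho>"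
    using real_arch_pow_inv[of \<rho> "1/2"] assms by auto
  then show thesis
    using ex_least_nat_less[of "\<lambda>n. (1/2) ^ n < \<rho>" n] assms that by (auto simp: not_less)
qed

lemma dist_le_on_closure:
  fixes U :: "'a::metric_space set"
  assumes "\<And>x y. x \<in> U \<Longrightarrow> y \<in> U \<Longrightarrow> dist x y \<le> e" and "x \<in> closure U" "y \<in> closure U"
  shows "dist x y \<le> e"
proof -
  have "closure U \<subseteq> cball u e" if "u \<in> U" for u
    using assms(1) that by (intro closure_minimal) auto
  then have "U \<subseteq> cball x e"
    using assms(2) by (fastforce simp: dist_commute)
  then have "closure U \<subseteq> cball x e"
    by (rule closure_minimal) simp
  then show ?thesis
    using assms(3) by auto
qed

lemma compact_decreasing_subset_open:
  fixes F :: "nat \<Rightarrow> 'a::heine_borel set"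
  assumes "\<And>n. compact (F n)" "\<And>m n. m \<le> n \<Longrightarrow> F n \<subseteq> F m" "open U" "(\<Inter>n. F n) \<subseteq> U"
  obtains n where "F n \<subseteq> U"
proof (rule ccontr)
  assume "\<not> thesis"
  then have "(\<Inter>n. F n - U) \<noteq> {}"
    using that assms(1-3) by (intro compact_nest compact_diff Diff_mono) auto
  then show False
    using assms(4) by blast
qed

locale dyadic_net =
  fixes X :: "'a::euclidean_space set" and \<beta> :: real
  assumes compact_X: "compact X" and \<beta>_pos: "0 < \<beta>"
begin

sublocale cell_net X dyadic_code "\<lambda>n. ((1/2) ^ n) powr \<beta>"
proof
  show "finite (dyadic_code n ` X)" for n
    using compact_X by (intro finite_dyadic_codes compact_imp_bounded)
  show "(\<lambda>n. ((1/2) ^ n) powr \<beta>) \<longlonglongrightarrow> 0"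
    using \<beta>_pos by (intro tendsto_zero_powrI[of _ _ "\<lambda>_. \<beta>" \<beta>] LIMSEQ_power_zero) auto
qed (auto intro: dyadic_code_refines)

lemma dist_cell_le: "x \<in> cell q \<Longrightarrow> y \<in> cell q \<Longrightarrow> dist x y \<le> DIM('a) * (1/2) ^ fst q"
  by (intro dist_le_if_dyadic_code_eq) (simp add: cell_def)

lemma heavy_if_measure_nonzero:
  assumes "hausdorff_measure dist \<beta> X \<noteq> 0"
  obtains c where "0 < c" "heavy c X"
proof -
  obtain e where e: "0 < e" and no_cover: "\<And>(S :: (nat \<times> ('a \<Rightarrow> int)) set) U w.
      finite S \<Longrightarrow> gauged_cover dist S U w X \<Longrightarrow> e \<le> (\<Sum>q\<in>S. w q powr \<beta>)"
    using hausdorff_measure_eq_0I_finite[OF \<beta>_pos, where A = X and d = dist] assms by (metis not_le)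
  have "heavy (e / DIM('a) powr \<beta>) X"
    unfolding heavy_def
  proof (intro allI impI)
    fix S assume S: "finite S" "X \<subseteq> \<Union> (cell ` S)"
    have "gauged_cover dist S cell (\<lambda>q. DIM('a) * (1/2) ^ fst q) X"
      using S(2) dist_cell_le by (auto simp: gauged_cover_def)
    then have "e \<le> (\<Sum>q\<in>S. (DIM('a) * (1/2) ^ fst q) powr \<beta>)"
      by (rule no_cover[OF S(1)])
    also have "\<dots> = DIM('a) powr \<beta> * weight S"
      by (simp add: weight_def powr_mult sum_distrib_left)
    finally show "e / DIM('a) powr \<beta> \<le> weight S"
      by (simp add: field_simps)
  qed
  then show thesis
    using that[of "e / DIM('a) powr \<beta>"] e by simp
qed

lemma ball_cell_cover:
  assumes \<rho>: "0 < \<rho>" "\<rho> \<le> 1"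
  obtains S where "finite S" "X \<inter> ball z \<rho> \<subseteq> \<Union> (cell ` S)"
    "weight S \<le> 3 ^ DIM('a) * 2 powr \<beta> * \<rho> powr \<beta>"
proof -
  obtain k where k: "(1/2) ^ Suc k < \<rho>" "\<rho> \<le> (1/2) ^ k"
    using between_half_powers[OF \<rho>] by blast
  define C where "C = Pi\<^sub>E (Basis :: 'a set) (\<lambda>i. {\<lfloor>2 ^ k * (z \<bullet> i)\<rfloor> - 1..\<lfloor>2 ^ k * (z \<bullet> i)\<rfloor> + 1})"
  have card_C: "card C = 3 ^ DIM('a)"
    by (simp add: C_def card_PiE)
  have "weight (Pair k ` C) = card C * ((1/2) ^ k) powr \<beta>"
    by (simp add: weight_def sum.reindex inj_on_def)
  also have "\<dots> \<le> card C * (2 * \<rho>) powr \<beta>"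
    using k(1) \<beta>_pos by (intro mult_left_mono powr_mono2) auto
  also have "\<dots> = 3 ^ DIM('a) * 2 powr \<beta> * \<rho> powr \<beta>"
    using \<rho> by (simp add: card_C powr_mult)
  finally have "weight (Pair k ` C) \<le> 3 ^ DIM('a) * 2 powr \<beta> * \<rho> powr \<beta>" .
  moreover have "X \<inter> ball z \<rho> \<subseteq> \<Union> (cell ` Pair k ` C)"
    using dyadic_codes_ball[OF k(2), of z] mem_cell_code[of _ k] unfolding C_def by blast
  moreover have "finite (Pair k ` C)"
    unfolding C_def by (intro finite_imageI finite_PiE) auto
  ultimately show thesis
    using that by blast
qed

lemma sum_cell_diameters_le:
  assumes deep: "\<And>q. q \<in> S \<Longrightarrow> n \<le> fst q" and s: "\<beta> \<le> s"
  shows "(\<Sum>q\<in>S. (DIM('a) * (1/2) ^ fst q) powr s)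
    \<le> DIM('a) powr s * (((1/2) ^ n) powr (s - \<beta>) * weight S)"
proof -
  have "(DIM('a) * (1/2) ^ fst q) powr s
      \<le> DIM('a) powr s * (((1/2) ^ n) powr (s - \<beta>) * ((1/2) ^ fst q) powr \<beta>)" if "q \<in> S" for q
  proof -
    have "(DIM('a) * (1/2) ^ fst q) powr s
        = DIM('a) powr s * (((1/2) ^ fst q) powr (s - \<beta>) * ((1/2) ^ fst q) powr \<beta>)"
      by (simp add: powr_mult flip: powr_add)
    also have "\<dots> \<le> DIM('a) powr s * (((1/2) ^ n) powr (s - \<beta>) * ((1/2) ^ fst q) powr \<beta>)"
      using s deep[OF that]
      by (intro mult_left_mono mult_right_mono powr_mono2 power_decreasing) auto
    finally show ?thesis .
  qed
  then show ?thesis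
    unfolding weight_def sum_distrib_left by (rule sum_mono)
qed

lemma exhausted_limit_measure_zero:
  assumes A: "exhausted c A" and s: "\<beta> < s"
  shows "hausdorff_measure dist s (\<Inter>n. closure (A n)) = 0"
proof (rule hausdorff_measure_eq_0I_finite)
  show "0 < s" using s \<beta>_pos by simp
  fix e :: real assume e: "0 < e"
  obtain W where W: "\<And>n. \<exists>m S. deep_cover n S (A m) \<and> weight S \<le> W"
    by (rule deep_covers_of_bounded_weight[OF A]) (rule that)
  have "(\<lambda>n. ((1/2::real) ^ n) powr (s - \<beta>)) \<longlonglongrightarrow> 0"
    using s by (intro tendsto_zero_powrI[of _ _ "\<lambda>_. s - \<beta>" "s - \<beta>"] LIMSEQ_power_zero) auto
  then have "(\<lambda>n. DIM('a) powr s * (((1/2) ^ n) powr (s - \<beta>) * W)) \<longlonglongrightarrow> DIM('a) powr s * (0 * W)"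
    by (intro tendsto_intros)
  then have "\<forall>\<^sub>F n in sequentially. DIM('a) powr s * (((1/2) ^ n) powr (s - \<beta>) * W) < e"
    using e by (intro order_tendstoD(2)) auto
  then obtain n where n: "DIM('a) powr s * (((1/2) ^ n) powr (s - \<beta>) * W) < e"
    unfolding eventually_sequentially by blast
  obtain m S where S: "finite S" "\<And>q. q \<in> S \<Longrightarrow> n \<le> fst q" "A m \<subseteq> \<Union> (cell ` S)" "weight S \<le> W"
    using W[of n] unfolding deep_cover_def by blast
  have "\<Union> (cell ` S) \<subseteq> (\<Union>q\<in>S. closure (cell q))"
    by (intro UN_mono order_refl closure_subset)
  then have "closure (A m) \<subseteq> (\<Union>q\<in>S. closure (cell q))"
    using S(1,3) by (intro closure_minimal closed_UN) auto
  then have cover: "gauged_cover dist S (\<lambda>q. closure (cell q)) (\<lambda>q. DIM('a) * (1/2) ^ fst q)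
      (\<Inter>n. closure (A n))"
    unfolding gauged_cover_def using dist_le_on_closure[OF dist_cell_le] by auto
  have "(\<Sum>q\<in>S. (DIM('a) * (1/2) ^ fst q) powr s)
    \<le> DIM('a) powr s * (((1/2) ^ n) powr (s - \<beta>) * weight S)"
    using S(2) s by (intro sum_cell_diameters_le) auto
  also have "\<dots> \<le> DIM('a) powr s * (((1/2) ^ n) powr (s - \<beta>) * W)"
    using S(4) by (intro mult_left_mono) auto
  also note n
  finally show "\<exists>(J :: (nat \<times> ('a \<Rightarrow> int)) set) U w.
      finite J \<and> gauged_cover dist J U w (\<Inter>n. closure (A n)) \<and> (\<Sum>j\<in>J. w j powr s) < e"
    using S(1) cover by blast
qed

lemma balls_cell_cover:
  assumes J: "finite J" and \<rho>: "\<And>j. j \<in> J \<Longrightarrow> 0 < \<rho> j" "\<And>j. j \<in> J \<Longrightarrow> \<rho> j \<le> 1"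
  obtains S where "finite S" "X \<inter> (\<Union>j\<in>J. ball (z j) (\<rho> j)) \<subseteq> \<Union> (cell ` S)"
    "weight S \<le> 3 ^ DIM('a) * 2 powr \<beta> * (\<Sum>j\<in>J. \<rho> j powr \<beta>)"
proof -
  define M where "M = 3 ^ DIM('a) * 2 powr \<beta>"
  have "\<forall>j\<in>J. \<exists>S. finite S \<and> X \<inter> ball (z j) (\<rho> j) \<subseteq> \<Union> (cell ` S) \<and> weight S \<le> M * \<rho> j powr \<beta>"
    unfolding M_def using ball_cell_cover[OF \<rho>] by metis
  then obtain S where S: "\<And>j. j \<in> J \<Longrightarrow> finite (S j)"
      "\<And>j. j \<in> J \<Longrightarrow> X \<inter> ball (z j) (\<rho> j) \<subseteq> \<Union> (cell ` S j)"
      "\<And>j. j \<in> J \<Longrightarrow> weight (S j) \<le> M * \<rho> j powr \<beta>"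
    by metis
  have "(\<Union>j\<in>J. X \<inter> ball (z j) (\<rho> j)) \<subseteq> (\<Union>j\<in>J. \<Union> (cell ` S j))"
    by (intro UN_mono S(2)) auto
  then have "X \<inter> (\<Union>j\<in>J. ball (z j) (\<rho> j)) \<subseteq> \<Union> (cell ` (\<Union>j\<in>J. S j))"
    by (simp add: UN_UN_flatten)
  moreover have "weight (\<Union>j\<in>J. S j) \<le> M * (\<Sum>j\<in>J. \<rho> j powr \<beta>)"
    unfolding sum_distrib_left by (rule order_trans[OF weight_UN_le[OF J S(1)] sum_mono[OF S(3)]])
  moreover have "finite (\<Union>j\<in>J. S j)"
    using J S(1) by blast
  ultimately show thesis
    using that unfolding M_def by blast
qed

lemma exhausted_limit_measure_nonzero:
  assumes A: "exhausted c A" and c: "0 < c"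
  shows "hausdorff_measure dist \<beta> (\<Inter>n. closure (A n)) \<noteq> 0"
proof
  assume null: "hausdorff_measure dist \<beta> (\<Inter>n. closure (A n)) = 0"
  have compact_A: "compact (closure (A n))" for n
    using bounded_subset[OF compact_imp_bounded[OF compact_X] exhausted_subset[OF A]] by simp
  define M where "M = 3 ^ DIM('a) * 2 powr \<beta>"
  have "compact (\<Inter>n. closure (A n))"
    using compact_A by (intro compact_Inter) auto
  moreover have "0 < min 1 (c / M)"
    using c by (simp add: M_def)
  ultimately obtain J :: "nat set" and z \<rho> where
      J: "finite J" and cover: "(\<Inter>n. closure (A n)) \<subseteq> (\<Union>j\<in>J. ball (z j) (\<rho> j))" and
      \<rho>_pos: "\<And>j. 0 < \<rho> j" and sum: "(\<Sum>j\<in>J. \<rho> j powr \<beta>) < min 1 (c / M)"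
    by (rule hausdorff_measure_eq_0_finite_ballsE[OF \<beta>_pos null]) (rule that)
  have "\<rho> j \<le> 1" if "j \<in> J" for j
  proof -
    have "\<rho> j powr \<beta> \<le> (\<Sum>j\<in>J. \<rho> j powr \<beta>)"
      using that J by (intro member_le_sum) auto
    then show ?thesis
      using sum \<beta>_pos ge_one_powr_ge_zero[of "\<rho> j" \<beta>] by linarith
  qed
  then obtain S where S: "finite S" "X \<inter> (\<Union>j\<in>J. ball (z j) (\<rho> j)) \<subseteq> \<Union> (cell ` S)"
      "weight S \<le> M * (\<Sum>j\<in>J. \<rho> j powr \<beta>)"
    by (rule balls_cell_cover[OF J \<rho>_pos, folded M_def]) (assumption, rule that)
  obtain m where "closure (A m) \<subseteq> (\<Union>j\<in>J. ball (z j) (\<rho> j))"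
    by (rule compact_decreasing_subset_open[OF compact_A _ _ cover])
      (auto intro!: closure_mono exhausted_mono[OF A])
  then have "A m \<subseteq> \<Union> (cell ` S)"
    using S(2) closure_subset[of "A m"] exhausted_subset[OF A, of m] by blast
  then have "c \<le> weight S"
    by (rule heavyD[OF exhausted_heavy[OF A] S(1)])
  also note S(3)
  also have "M * (\<Sum>j\<in>J. \<rho> j powr \<beta>) < M * (c / M)"
    using sum by (intro mult_strict_left_mono) (auto simp: M_def)
  finally show False
    by (simp add: M_def)
qed

end

text \<open>A weak form of Besicovitch's theorem on subsets of finite measure.\<close>

theorem compact_subset_of_exact_dimension:
  fixes X :: "'a::euclidean_space set"
  assumes X: "compact X" and \<beta>: "0 < \<beta>" and dim: "ereal \<beta> \<le> hausdorff_dim dist X"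
  obtains K where "K \<subseteq> X" "compact K" "hausdorff_dim dist K = ereal \<beta>"
proof (cases "hausdorff_measure dist \<beta> X = 0")
  case True
  then have "hausdorff_dim dist X = ereal \<beta>"
    using dim \<beta> hausdorff_dim_le_if_null[of \<beta> dist X] by simp
  then show thesis
    using that X by blast
next
  case False
  interpret dyadic_net X \<beta>
    using X \<beta> by unfold_locales
  obtain c where c: "0 < c" "heavy c X"
    using heavy_if_measure_nonzero[OF False] .
  obtain A where A: "exhausted c A"
    using exhausted_sequence_exists[OF c(2)] .
  define K where "K = (\<Inter>n. closure (A n))"
  have "hausdorff_dim dist K \<le> ereal s" if "\<beta> < s" for s
    using that \<beta> exhausted_limit_measure_zero[OF A that]
    by (intro hausdorff_dim_le_if_null) (auto simp: K_def)
  then have "hausdorff_dim dist K \<le> ereal \<beta>"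
    by (metis ereal_dense2 ereal_less_eq(3) leD not_le)
  moreover have "ereal \<beta> \<le> hausdorff_dim dist K"
    using exhausted_limit_measure_nonzero[OF A c(1)] hausdorff_measure_null_if_dim_less
    unfolding K_def by (metis not_le)
  moreover have "K \<subseteq> X"
    using closure_minimal[OF exhausted_subset[OF A] compact_imp_closed[OF X], of 0]
    by (auto simp: K_def)
  moreover have "closed K"
    by (auto simp: K_def)
  ultimately show thesis
    using that[of K] compact_Int_closed[OF X, of K] by (simp add: Int_absorb1)
qed

subsection \<open>Splittings with small graphs\<close>

definition box_content_less :: "real \<Rightarrow> real \<Rightarrow> 'a::metric_space set \<Rightarrow> bool" where
  "box_content_less s e A \<longleftrightarrow>
     (\<exists>\<C> d. finite \<C> \<and> 0 < d \<and> gauged_cover dist \<C> (\<lambda>C. C) (\<lambda>_. d) A \<and> card \<C> * d powr s < e)"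

definition far_part :: "'a::metric_space set \<Rightarrow> 'a set \<Rightarrow> real \<Rightarrow> 'a set" where
  "far_part I K \<rho> = {x \<in> I. \<rho> \<le> infdist x K}"

definition graph_on :: "'a set \<Rightarrow> ('a \<Rightarrow> 'b) \<Rightarrow> ('a \<times> 'b) set" where
  "graph_on A g = (\<lambda>x. (x, g x)) ` A"

lemma box_content_less_mono:
  "box_content_less s e B \<Longrightarrow> A \<subseteq> B \<Longrightarrow> e \<le> e' \<Longrightarrow> box_content_less s e' A"
  unfolding box_content_less_def by (meson gauged_cover_subset less_le_trans)

lemma hausdorff_measure_null_if_box_content_less:
  assumes "0 < s" "\<And>e. 0 < e \<Longrightarrow> box_content_less s e A"
  shows "hausdorff_measure dist s A = 0"
proof (rule hausdorff_measure_eq_0I_finite[OF \<open>0 < s\<close>])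
  fix e :: real assume "0 < e"
  then obtain \<C> and d :: real
    where "finite \<C>" "gauged_cover dist \<C> (\<lambda>C. C) (\<lambda>_. d) A" "card \<C> * d powr s < e"
    using assms(2) unfolding box_content_less_def by blast
  then show "\<exists>(J :: 'a set set) U w. finite J \<and> gauged_cover dist J U w A \<and> (\<Sum>j\<in>J. w j powr s) < e"
    by (intro exI[of _ \<C>] exI[of _ "\<lambda>C. C"] exI[of _ "\<lambda>_. d"]) simp
qed

lemma box_content_less_perturb:
  assumes "box_content_less s e (g ` A)"
  obtains \<eta> where "0 < \<eta>"
    "\<And>h. (\<And>x. x \<in> A \<Longrightarrow> dist (h x) (g x) \<le> \<eta>) \<Longrightarrow> box_content_less s e (h ` A)"
proof -
  obtain \<C> and d :: real where \<C>: "finite \<C>" "0 < d"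
      "gauged_cover dist \<C> (\<lambda>C. C) (\<lambda>_. d) (g ` A)" "card \<C> * d powr s < e"
    using assms unfolding box_content_less_def by blast
  have "((\<lambda>t. card \<C> * t powr s) \<longlongrightarrow> card \<C> * d powr s) (at_right d)"
    using \<C>(2) by (intro tendsto_intros) auto
  then have "\<forall>\<^sub>F t in at_right d. card \<C> * t powr s < e \<and> d < t"
    using \<C>(4) by (intro eventually_conj order_tendstoD(2) eventually_at_right_less)
  then obtain d' where d': "card \<C> * d' powr s < e" "d < d'"
    using eventually_happens by fastforce
  show thesis
  proof
    show "0 < (d' - d) / 2" using d'(2) by simp
    fix h assume h: "\<And>x. x \<in> A \<Longrightarrow> dist (h x) (g x) \<le> (d' - d) / 2"
    define \<C>' where "\<C>' = (\<lambda>C. h ` {x \<in> A. g x \<in> C}) ` \<C>"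
    have "dist (h x) (h y) \<le> d'" if "x \<in> A" "y \<in> A" "dist (g x) (g y) \<le> d" for x y
      using h[OF that(1)] h[OF that(2)] that(3)
        dist_triangle[of "h x" "h y" "g x"] dist_triangle2[of "g x" "h y" "g y"]
      by (simp add: field_simps)
    moreover have "h ` A \<subseteq> \<Union> \<C>'"
      using \<C>(3) unfolding gauged_cover_def \<C>'_def by blast
    ultimately have "gauged_cover dist \<C>' (\<lambda>C. C) (\<lambda>_. d') (h ` A)"
      using \<C>(2,3) d'(2) by (auto simp: gauged_cover_def \<C>'_def)
    moreover have "card \<C>' * d' powr s < e"
      using card_image_le[OF \<C>(1), of "\<lambda>C. h ` {x \<in> A. g x \<in> C}"] d'(1) unfolding \<C>'_def
      by (intro le_less_trans[OF mult_right_mono d'(1)]) auto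
    ultimately show "box_content_less s e (h ` A)"
      unfolding box_content_less_def using \<C>(1,2) d'(2)
      by (intro exI[of _ \<C>'] exI[of _ d']) (auto simp: \<C>'_def)
  qed
qed

lemma box_content_less_Lipschitz_image:
  fixes g :: "real \<Rightarrow> 'b::metric_space"
  assumes g: "L-lipschitz_on A g" and A: "A \<subseteq> {a..b}" and s: "1 < s" and e: "0 < e"
  shows "box_content_less s e (g ` A)"
proof -
  have L: "0 \<le> L" using g by (rule lipschitz_on_nonneg)
  have "((\<lambda>N. (N * \<bar>b - a\<bar> + 2) * ((L + 1) / N) powr s) \<longlongrightarrow> 0) at_top"
    using s L by real_asymp
  then have "\<forall>\<^sub>F N in at_top. (N * \<bar>b - a\<bar> + 2) * ((L + 1) / N) powr s < e \<and> 0 < N"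
    using e by (intro eventually_conj order_tendstoD(2) eventually_gt_at_top)
  then obtain N :: real where N: "(N * \<bar>b - a\<bar> + 2) * ((L + 1) / N) powr s < e" "0 < N"
    using eventually_happens by fastforce
  define \<C> where "\<C> = (\<lambda>j. g ` {x \<in> A. \<lfloor>N * x\<rfloor> = j}) ` {\<lfloor>N * a\<rfloor>..\<lfloor>N * b\<rfloor>}"
  have "dist (g x) (g y) \<le> (L + 1) / N" if "x \<in> A" "y \<in> A" "\<lfloor>N * x\<rfloor> = \<lfloor>N * y\<rfloor>" for x y
  proof -
    have "\<bar>N * x - N * y\<bar> \<le> 1" using that(3) by linarith
    then have "dist x y \<le> 1 / N"
      using N(2) by (simp add: dist_real_def field_simps abs_le_iff)
    then have "L * dist x y \<le> (L + 1) * (1 / N)"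
      using L N(2) by (intro mult_mono) auto
    then show ?thesis
      using lipschitz_onD[OF g that(1,2)] by simp
  qed
  moreover have "g ` A \<subseteq> \<Union> \<C>"
    using A N(2) unfolding \<C>_def by (fastforce intro!: floor_mono mult_left_mono)
  ultimately have cover: "gauged_cover dist \<C> (\<lambda>C. C) (\<lambda>_. (L + 1) / N) (g ` A)"
    using L N(2) by (auto simp: gauged_cover_def \<C>_def)
  have "real (card \<C>) \<le> card {\<lfloor>N * a\<rfloor>..\<lfloor>N * b\<rfloor>}"
    unfolding \<C>_def of_nat_le_iff by (rule card_image_le) simp
  also have "\<dots> \<le> N * \<bar>b - a\<bar> + 2"
  proof -
    have "N * b - N * a \<le> N * \<bar>b - a\<bar>" "0 \<le> N * \<bar>b - a\<bar>"
      using N(2) by (simp_all flip: right_diff_distrib)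
    then show ?thesis by (simp; linarith)
  qed
  finally have "card \<C> * ((L + 1) / N) powr s < e"
    using N(1) by (meson le_less_trans mult_right_mono powr_ge_zero)
  then show ?thesis
    unfolding box_content_less_def using cover L N(2)
    by (intro exI[of _ \<C>] exI[of _ "(L + 1) / N"]) (auto simp: \<C>_def)
qed

lemma Lipschitz_approximation:
  fixes f :: "real \<Rightarrow> 'b::euclidean_space"
  assumes "continuous_on {a..b} f" "0 < e"
  obtains p L where "L-lipschitz_on {a..b} p" "\<And>x. x \<in> {a..b} \<Longrightarrow> norm (f x - p x) < e"
proof -
  obtain p where p: "polynomial_function p" "\<And>x. x \<in> {a..b} \<Longrightarrow> norm (f x - p x) < e"
    using Stone_Weierstrass_polynomial_function[OF compact_Icc assms] by blast
  obtain p' where p': "polynomial_function p'" "\<And>x. (p has_vector_derivative p' x) (at x)"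
    using has_vector_derivative_polynomial_function[OF p(1)] by blast
  have "bounded (p' ` {a..b})"
    by (intro compact_imp_bounded compact_continuous_image continuous_on_polymonial_function p'(1))
      simp
  then obtain L where L: "0 < L" "\<And>x. x \<in> {a..b} \<Longrightarrow> norm (p' x) \<le> L"
    by (auto simp: bounded_pos)
  have "L-lipschitz_on {a..b} p"
  proof (rule bounded_derivative_imp_lipschitz)
    show "(p has_derivative (\<lambda>h. h *\<^sub>R p' x)) (at x within {a..b})" for x
      using has_vector_derivative_at_within[OF p'(2)] by (simp add: has_vector_derivative_def)
    show "onorm (\<lambda>h. h *\<^sub>R p' x) \<le> L" if "x \<in> {a..b}" for x
      using L(2)[OF that] by (simp add: onorm_scaleR_left bounded_linear_ident onorm_id)
  qed (use L(1) in auto)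
  then show thesis
    using that p(2) by blast
qed

text \<open>A pair \<open>(l, w)\<close> encodes the interval \<open>{l..l + w}\<close>, so the constraint on second components
  says that both \<open>v x\<close> and \<open>u x - v x\<close> encode intervals.\<close>

definition splittings ::
    "'a set \<Rightarrow> 'a set \<Rightarrow> ('a::metric_space \<Rightarrow>\<^sub>C (real \<times> real)) \<Rightarrow> ('a \<Rightarrow>\<^sub>C (real \<times> real)) set" where
  "splittings I K u = {v :: 'a \<Rightarrow>\<^sub>C (real \<times> real). (\<forall>x\<in>K. v x = (1/2) *\<^sub>R u x) \<and>
     (\<forall>x\<in>I. 0 \<le> snd (v x) \<and> snd (v x) \<le> snd (u x))}"

lemma closed_splittings: "closed (splittings I K u)"
proof -
  have "splittings I K u = PiC UNIV (\<lambda>x. {y. (x \<in> K \<longrightarrow> y = (1/2) *\<^sub>R u x) \<and>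
      (x \<in> I \<longrightarrow> 0 \<le> snd y \<and> snd y \<le> snd (u x))})"
    by (auto simp: splittings_def mem_PiC_iff Pi_iff)
  moreover have "closed {y. (x \<in> K \<longrightarrow> y = (1/2) *\<^sub>R u x) \<and>
      (x \<in> I \<longrightarrow> 0 \<le> snd y \<and> snd y \<le> snd (u x))}" for x
    by (intro closed_Collect_conj closed_Collect_imp closed_Collect_eq closed_Collect_le
        open_Collect_const continuous_intros)
  ultimately show ?thesis
    by (simp add: closed_PiC)
qed

lemma half_in_splittings:
  fixes u :: "'a::metric_space \<Rightarrow>\<^sub>C (real \<times> real)"
  shows "(\<And>x. x \<in> I \<Longrightarrow> 0 \<le> snd (u x)) \<Longrightarrow> (1/2) *\<^sub>R u \<in> splittings I K u"
  by (simp add: splittings_def)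

lemma splittings_reflect: "v \<in> splittings I K u \<Longrightarrow> u - v \<in> splittings I K u"
  by (auto simp: splittings_def prod_eq_iff)

definition thin_splittings ::
    "real \<Rightarrow> real \<Rightarrow> 'a set \<Rightarrow> 'a set \<Rightarrow> ('a::metric_space \<Rightarrow>\<^sub>C (real \<times> real)) \<Rightarrow>
      ('a \<Rightarrow>\<^sub>C (real \<times> real)) set" where
  "thin_splittings s \<rho> I K u =
     {v \<in> splittings I K u. box_content_less s \<rho> (graph_on (far_part I K \<rho>) v)}"

lemma openin_thin_splittings: "openin (top_of_set (splittings I K u)) (thin_splittings s \<rho> I K u)"
  unfolding openin_euclidean_subtopology_iff
proof (intro conjI ballI)
  show "thin_splittings s \<rho> I K u \<subseteq> splittings I K u"
    by (auto simp: thin_splittings_def)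
  fix v assume "v \<in> thin_splittings s \<rho> I K u"
  then obtain \<eta> where \<eta>: "0 < \<eta>"
      "\<And>h. (\<And>x. x \<in> far_part I K \<rho> \<Longrightarrow> dist (h x) (x, v x) \<le> \<eta>) \<Longrightarrow>
        box_content_less s \<rho> (h ` far_part I K \<rho>)"
    unfolding thin_splittings_def graph_on_def
    using box_content_less_perturb[of s \<rho> "\<lambda>x. (x, v x)" "far_part I K \<rho>"] by blast
  have "box_content_less s \<rho> (graph_on (far_part I K \<rho>) v')" if "dist v' v < \<eta>" for v'
    unfolding graph_on_def
  proof (rule \<eta>(2))
    show "dist (x, v' x) (x, v x) \<le> \<eta>" for x
      using dist_bounded[of v' x v] that by (simp add: dist_Pair_Pair)
  qed
  then show "\<exists>\<eta>>0. \<forall>v'\<in>splittings I K u. dist v' v < \<eta> \<longrightarrow> v' \<in> thin_splittings s \<rho> I K u"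
    using \<eta>(1) by (auto simp: thin_splittings_def)
qed

lemma Lipschitz_approximation_below_snd:
  fixes v :: "real \<Rightarrow> real \<times> real"
  assumes v: "continuous_on {a..b} v" "\<And>x. x \<in> {a..b} \<Longrightarrow> 0 \<le> snd (v x)" and "0 < \<epsilon>"
  obtains p L where "L-lipschitz_on {a..b} p" "\<And>x. x \<in> {a..b} \<Longrightarrow> norm (p x - v x) \<le> \<epsilon>"
    "\<And>x. x \<in> {a..b} \<Longrightarrow> 0 \<le> snd (p x) \<and> snd (p x) \<le> snd (v x)"
proof -
  define \<delta> where "\<delta> = \<epsilon> / 3"
  have "0 < \<delta>"
    using \<open>0 < \<epsilon>\<close> by (simp add: \<delta>_def)
  then obtain q L where q: "L-lipschitz_on {a..b} q" "\<And>x. x \<in> {a..b} \<Longrightarrow> norm (v x - q x) < \<delta>"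
    by (rule Lipschitz_approximation[OF v(1)]) (rule that)
  define p where "p x = (fst (q x), max 0 (snd (q x) - \<delta>))" for x
  have p_bounds: "norm (p x - v x) \<le> \<epsilon> \<and> 0 \<le> snd (p x) \<and> snd (p x) \<le> snd (v x)"
    if "x \<in> {a..b}" for x
  proof -
    have "\<bar>fst (v x) - fst (q x)\<bar> < \<delta>" "\<bar>snd (v x) - snd (q x)\<bar> < \<delta>"
      using q(2)[OF that] dist_fst_le[of "v x" "q x"] dist_snd_le[of "v x" "q x"]
      by (auto simp: dist_norm)
    moreover have "fst (p x) = fst (q x)" "snd (p x) = max 0 (snd (q x) - \<delta>)" "\<epsilon> = 3 * \<delta>"
      by (simp_all add: p_def \<delta>_def)
    moreover have "norm (p x - v x) \<le> \<bar>fst (p x) - fst (v x)\<bar> + \<bar>snd (p x) - snd (v x)\<bar>"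
      by (metis fst_diff norm_Pair_le prod.collapse real_norm_def snd_diff)
    ultimately show ?thesis
      using v(2)[OF that] by (intro conjI) linarith+
  qed
  have "(sqrt (L\<^sup>2 + L\<^sup>2))-lipschitz_on {a..b} p"
    unfolding p_def
  proof (intro lipschitz_on_Pair lipschitz_onI)
    fix x y assume xy: "x \<in> {a..b}" "y \<in> {a..b}"
    have "dist (q x) (q y) \<le> L * dist x y"
      by (rule lipschitz_onD[OF q(1) xy])
    then show "dist (fst (q x)) (fst (q y)) \<le> L * dist x y"
        "dist (max 0 (snd (q x) - \<delta>)) (max 0 (snd (q y) - \<delta>)) \<le> L * dist x y"
      using dist_fst_le[of "q x" "q y"] dist_snd_le[of "q x" "q y"] by (auto simp: dist_real_def)
  qed (use lipschitz_on_nonneg[OF q(1)] in auto)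
  then show thesis
    using that p_bounds by blast
qed

lemma splittings_interpolate:
  fixes u v c :: "'a::metric_space \<Rightarrow>\<^sub>C (real \<times> real)"
  assumes v: "v \<in> splittings I K u" and "K \<subseteq> I"
    and c: "\<And>x. x \<in> I \<Longrightarrow> c x = t x *\<^sub>R (p x - v x)"
    and t: "\<And>x. 0 \<le> t x" "\<And>x. t x \<le> 1" "\<And>x. x \<in> K \<Longrightarrow> t x = 0"
    and p: "\<And>x. x \<in> I \<Longrightarrow> 0 \<le> snd (p x) \<and> snd (p x) \<le> snd (v x)"
  shows "v + c \<in> splittings I K u"
  unfolding splittings_def
proof (intro CollectI conjI ballI)
  fix x assume "x \<in> K"
  then show "(v + c) x = (1/2) *\<^sub>R u x"
    using v c[of x] t(3)[of x] \<open>K \<subseteq> I\<close> by (auto simp: splittings_def)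
next
  fix x assume x: "x \<in> I"
  have "snd (c x) = t x * (snd (p x) - snd (v x))"
    using c[OF x] by simp
  then have "snd ((v + c) x) = (1 - t x) * snd (v x) + t x * snd (p x)"
    by (simp add: algebra_simps)
  moreover have "0 \<le> snd (v x)" "snd (v x) \<le> snd (u x)"
    using v x by (auto simp: splittings_def)
  moreover have "t x * snd (p x) \<le> t x * snd (v x)"
    using p[OF x] t(1) by (intro mult_left_mono) auto
  moreover have "0 \<le> (1 - t x) * snd (v x)" "0 \<le> t x * snd (p x)"
    using p[OF x] t(1,2)[of x] calculation(2) by simp_all
  ultimately show "0 \<le> snd ((v + c) x)" "snd ((v + c) x) \<le> snd (u x)"
    by (simp_all add: algebra_simps)
qed

lemma bounded_on_interval_bcontfunE:
  fixes f :: "real \<Rightarrow> 'b::real_normed_vector"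
  assumes "a \<le> b" "continuous_on {a..b} f" "\<And>x. x \<in> {a..b} \<Longrightarrow> norm (f x) \<le> \<epsilon>"
  obtains g :: "real \<Rightarrow>\<^sub>C 'b" where "\<And>x. x \<in> {a..b} \<Longrightarrow> g x = f x" "norm g \<le> \<epsilon>"
proof -
  obtain g :: "real \<Rightarrow>\<^sub>C 'b" where g: "\<And>x. x \<in> {a..b} \<Longrightarrow> g x = f x" "\<And>x. g x = f (clamp a b x)"
    by (rule continuous_on_cbox_bcontfunE[of a b f]) (use assms(2) that in auto)
  moreover have "clamp a b x \<in> {a..b}" for x
    using clamp_in_interval[of a b x] \<open>a \<le> b\<close> by simp
  ultimately show thesis
    using that[of g] assms(3) by (metis norm_bound)
qed

text \<open>The interpolation weight \<open>t\<close> vanishes on \<open>K\<close>, where \<open>v\<close> is prescribed, and is \<open>1\<close> at distance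
  at least \<open>\<rho>\<close> from \<open>K\<close>, where only the Lipschitz approximation remains.\<close>

lemma Lipschitz_splitting_nearby:
  fixes u v :: "real \<Rightarrow>\<^sub>C (real \<times> real)"
  assumes "a \<le> b" "K \<subseteq> {a..b}" and v: "v \<in> splittings {a..b} K u" and "0 < \<rho>" "0 < \<epsilon>"
  obtains v' L where "v' \<in> splittings {a..b} K u" "dist v' v \<le> \<epsilon>"
    "L-lipschitz_on (far_part {a..b} K \<rho>) v'"
proof -
  have "0 \<le> snd (v x)" if "x \<in> {a..b}" for x
    using v that by (simp add: splittings_def)
  then obtain p L where Lipschitz: "L-lipschitz_on {a..b} p"
      and near: "\<And>x. x \<in> {a..b} \<Longrightarrow> norm (p x - v x) \<le> \<epsilon>"
      and below: "\<And>x. x \<in> {a..b} \<Longrightarrow> 0 \<le> snd (p x) \<and> snd (p x) \<le> snd (v x)"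
    by (rule Lipschitz_approximation_below_snd[OF continuous_on_apply_bcontfun _ \<open>0 < \<epsilon>\<close>])
      (assumption, rule that)
  define t where "t x = min 1 (infdist x K / \<rho>)" for x
  have t: "0 \<le> t x" "t x \<le> 1" "x \<in> K \<Longrightarrow> t x = 0" for x
    using \<open>0 < \<rho>\<close> by (auto simp: t_def infdist_nonneg)
  have "continuous_on {a..b} (\<lambda>x. t x *\<^sub>R (p x - v x))"
    unfolding t_def using lipschitz_on_continuous_on[OF Lipschitz] \<open>0 < \<rho>\<close>
    by (intro continuous_intros) auto
  moreover have "norm (t x *\<^sub>R (p x - v x)) \<le> \<epsilon>" if "x \<in> {a..b}" for x
    using mult_mono[OF t(2) near[OF that]] t(1)[of x] by simp
  ultimately obtain c :: "real \<Rightarrow>\<^sub>C (real \<times> real)"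
    where c: "\<And>x. x \<in> {a..b} \<Longrightarrow> c x = t x *\<^sub>R (p x - v x)" "norm c \<le> \<epsilon>"
    by (rule bounded_on_interval_bcontfunE[OF \<open>a \<le> b\<close>]) (assumption, rule that)
  show thesis
  proof
    show "v + c \<in> splittings {a..b} K u"
      by (rule splittings_interpolate[OF v \<open>K \<subseteq> {a..b}\<close> c(1) t below])
    show "dist (v + c) v \<le> \<epsilon>"
      using c(2) by (simp add: dist_norm)
    have "(v + c) x = p x" if "x \<in> far_part {a..b} K \<rho>" for x
      using that c(1)[of x] \<open>0 < \<rho>\<close> by (simp add: t_def far_part_def)
    then show "L-lipschitz_on (far_part {a..b} K \<rho>) (v + c)"
      by (rule lipschitz_on_transform[OF lipschitz_on_subset[OF Lipschitz], rotated])
        (auto simp: far_part_def)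
  qed
qed

lemma dense_thin_splittings:
  fixes u :: "real \<Rightarrow>\<^sub>C (real \<times> real)"
  assumes "a \<le> b" "K \<subseteq> {a..b}" "1 < s" "0 < \<rho>"
  shows "splittings {a..b} K u \<subseteq> closure (thin_splittings s \<rho> {a..b} K u)"
proof
  fix v assume v: "v \<in> splittings {a..b} K u"
  show "v \<in> closure (thin_splittings s \<rho> {a..b} K u)"
    unfolding closure_approachable_le
  proof (intro allI impI)
    fix \<epsilon> :: real assume "0 < \<epsilon>"
    then obtain v' L where v': "v' \<in> splittings {a..b} K u" "dist v' v \<le> \<epsilon>"
        "L-lipschitz_on (far_part {a..b} K \<rho>) v'"
      using Lipschitz_splitting_nearby[OF assms(1,2) v \<open>0 < \<rho>\<close>] by blast
    have "far_part {a..b} K \<rho> \<subseteq> {a..b}"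
      by (auto simp: far_part_def)
    then have "box_content_less s \<rho> (graph_on (far_part {a..b} K \<rho>) v')"
      unfolding graph_on_def using \<open>1 < s\<close> \<open>0 < \<rho>\<close>
      by (rule box_content_less_Lipschitz_image[OF lipschitz_on_Pair[OF lipschitz_on_id v'(3)]])
    then show "\<exists>v'\<in>thin_splittings s \<rho> {a..b} K u. dist v' v \<le> \<epsilon>"
      using v'(1,2) by (auto simp: thin_splittings_def)
  qed
qed

lemma Baire_complete_subspace:
  fixes Y :: "'a::complete_space set"
  assumes "closed Y" "Y \<noteq> {}" "countable \<G>"
    and "\<And>T. T \<in> \<G> \<Longrightarrow> openin (top_of_set Y) T" "\<And>T. T \<in> \<G> \<Longrightarrow> Y \<subseteq> closure T"
  shows "Y \<inter> \<Inter>\<G> \<noteq> {}"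
proof -
  have "completely_metrizable_space (top_of_set Y)"
    using \<open>closed Y\<close>
    by (intro completely_metrizable_space_closedin completely_metrizable_space_euclidean) simp
  moreover have "top_of_set Y closure_of T = topspace (top_of_set Y)" if "T \<in> \<G>" for T
    using assms(5)[OF that] openin_imp_subset[OF assms(4)[OF that]]
    by (simp add: closure_of_subtopology Int_absorb1 Int_absorb2)
  ultimately have "top_of_set Y closure_of \<Inter>\<G> = Y"
    using assms(3,4) Baire_category[of "top_of_set Y" \<G>] by simp
  then have "Y \<inter> closure (Y \<inter> \<Inter>\<G>) = Y"
    by (simp add: closure_of_subtopology)
  then show ?thesis
    using \<open>Y \<noteq> {}\<close> by auto
qed

lemma thin_splittings_mono:
  assumes "\<rho> \<le> \<rho>'"
  shows "thin_splittings s \<rho> I K u \<subseteq> thin_splittings s \<rho>' I K (u :: 'a::metric_space \<Rightarrow>\<^sub>C _)"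
proof -
  have "graph_on (far_part I K \<rho>') v \<subseteq> graph_on (far_part I K \<rho>) v" for v :: "'a \<Rightarrow> real \<times> real"
    using assms by (auto simp: graph_on_def far_part_def)
  then show ?thesis
    unfolding thin_splittings_def using assms box_content_less_mono by blast
qed

lemma dense_reflect:
  fixes u :: "'a::real_normed_vector"
  assumes "Y \<subseteq> closure T" "T \<subseteq> Y" "\<And>v. v \<in> Y \<Longrightarrow> u - v \<in> Y"
  shows "Y \<subseteq> closure (Y \<inter> (-) u -` T)"
proof
  fix v assume "v \<in> Y"
  then have "u - v \<in> closure T"
    using assms by blast
  show "v \<in> closure (Y \<inter> (-) u -` T)"
    unfolding closure_approachable
  proof (intro allI impI)
    fix \<epsilon> :: real assume "0 < \<epsilon>"
    then obtain z where z: "z \<in> T" "dist z (u - v) < \<epsilon>"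
      using \<open>u - v \<in> closure T\<close> unfolding closure_approachable by blast
    moreover have "dist (u - z) v = dist z (u - v)"
      by (simp add: dist_norm norm_minus_commute algebra_simps)
    ultimately show "\<exists>y\<in>Y \<inter> (-) u -` T. dist y v < \<epsilon>"
      using assms(2,3) by (intro bexI[of _ "u - z"]) auto
  qed
qed

lemma thin_splitting_exists:
  fixes u :: "real \<Rightarrow>\<^sub>C (real \<times> real)"
  assumes "a \<le> b" "K \<subseteq> {a..b}" "1 < s" and u: "\<And>x. x \<in> {a..b} \<Longrightarrow> 0 \<le> snd (u x)"
  obtains v where "\<And>\<rho>. 0 < \<rho> \<Longrightarrow>
    v \<in> thin_splittings s \<rho> {a..b} K u \<and> u - v \<in> thin_splittings s \<rho> {a..b} K u"
proof -
  define Y where "Y = splittings {a..b} K u"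
  define T where "T n = thin_splittings s (1 / real (Suc n)) {a..b} K u" for n
  define T' where "T' n = Y \<inter> (-) u -` T n" for n
  have reflect: "u - v \<in> Y" if "v \<in> Y" for v
    using that by (simp add: Y_def splittings_reflect)
  have T: "openin (top_of_set Y) (T n)" "Y \<subseteq> closure (T n)" for n
    unfolding Y_def T_def by (intro openin_thin_splittings dense_thin_splittings assms(1-3); simp)+
  have T': "openin (top_of_set Y) (T' n)" "Y \<subseteq> closure (T' n)" for n
    unfolding T'_def using reflect dense_reflect[OF T(2) openin_imp_subset[OF T(1)]]
    by (auto intro!: continuous_openin_preimage[OF _ _ T(1)] continuous_intros)
  have "Y \<inter> \<Inter> (range T \<union> range T') \<noteq> {}"
  proof (rule Baire_complete_subspace)
    show "closed Y"
      by (simp add: Y_def closed_splittings)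
    show "Y \<noteq> {}"
      using half_in_splittings[of "{a..b}" u K] u by (auto simp: Y_def)
    show "openin (top_of_set Y) S" "Y \<subseteq> closure S" if "S \<in> range T \<union> range T'" for S
      using that T T' by blast+
  qed simp
  then obtain v where "v \<in> \<Inter> (range T \<union> range T')"
    by blast
  then have v: "v \<in> T n" "v \<in> T' n" for n
    by auto
  show thesis
  proof
    fix \<rho> :: real assume "0 < \<rho>"
    then obtain n where "1 / real (Suc n) < \<rho>"
      using nat_approx_posE by blast
    then have "T n \<subseteq> thin_splittings s \<rho> {a..b} K u"
      unfolding T_def by (intro thin_splittings_mono) simp
    then show "v \<in> thin_splittings s \<rho> {a..b} K u \<and> u - v \<in> thin_splittings s \<rho> {a..b} K u"
      using v unfolding T'_def by blast
  qed
qed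

lemma thin_splitting_graph_null_off:
  fixes v :: "'a::metric_space \<Rightarrow>\<^sub>C (real \<times> real)"
  assumes "\<And>\<rho>. 0 < \<rho> \<Longrightarrow> v \<in> thin_splittings s \<rho> I K u" "0 < s" "closed K" "K \<noteq> {}"
  shows "hausdorff_measure dist s (graph_on (I - K) v) = 0"
proof -
  have "hausdorff_measure dist s (graph_on (far_part I K \<rho>) v) = 0" if "0 < \<rho>" for \<rho>
  proof (rule hausdorff_measure_null_if_box_content_less[OF \<open>0 < s\<close>])
    fix e :: real assume "0 < e"
    then have "box_content_less s (min e \<rho>) (graph_on (far_part I K (min e \<rho>)) v)"
      using assms(1)[of "min e \<rho>"] that by (simp add: thin_splittings_def)
    then show "box_content_less s e (graph_on (far_part I K \<rho>) v)"
      by (rule box_content_less_mono) (auto simp: graph_on_def far_part_def)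
  qed
  then have "hausdorff_measure dist s (\<Union>n. graph_on (far_part I K (1 / real (Suc n))) v) = 0"
    using \<open>0 < s\<close> by (intro hausdorff_measure_null_UN) auto
  moreover have "graph_on (I - K) v \<subseteq> (\<Union>n. graph_on (far_part I K (1 / real (Suc n))) v)"
  proof
    fix z assume "z \<in> graph_on (I - K) v"
    then obtain x where x: "x \<in> I" "x \<notin> K" "z = (x, v x)"
      by (auto simp: graph_on_def)
    then obtain n where "1 / real (Suc n) < infdist x K"
      using infdist_pos_not_in_closed[OF assms(3,4)] nat_approx_posE by blast
    then have "z \<in> graph_on (far_part I K (1 / real (Suc n))) v"
      using x by (simp add: graph_on_def far_part_def)
    then show "z \<in> (\<Union>n. graph_on (far_part I K (1 / real (Suc n))) v)"
      by blast
  qed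
  ultimately show ?thesis
    using hausdorff_measure_null_subset[OF \<open>0 < s\<close>] by blast
qed

lemma hausdorff_dim_graph_on_scaleR:
  fixes g :: "'a::real_normed_vector \<Rightarrow> 'b::real_normed_vector"
  assumes "c \<noteq> 0"
  shows "hausdorff_dim dist (graph_on A (\<lambda>x. c *\<^sub>R g x)) = hausdorff_dim dist (graph_on A g)"
proof -
  have scaled_le: "hausdorff_dim dist (graph_on A (\<lambda>x. c *\<^sub>R g x)) \<le> hausdorff_dim dist (graph_on A g)"
    for c and g :: "'a \<Rightarrow> 'b"
  proof -
    have "bounded_linear (\<lambda>z :: 'a \<times> 'b. (fst z, c *\<^sub>R snd z))"
      by (intro bounded_linear_intros)
    then obtain L where L: "L-lipschitz_on (graph_on A g) (\<lambda>z. (fst z, c *\<^sub>R snd z))"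
      by (rule bounded_linear.lipschitz_boundE)
    have "hausdorff_dim dist ((\<lambda>z. (fst z, c *\<^sub>R snd z)) ` graph_on A g)
        \<le> hausdorff_dim dist (graph_on A g)"
      using lipschitz_on_nonneg[OF L] lipschitz_onD[OF L] by (rule hausdorff_dim_Lipschitz_image)
    then show ?thesis
      by (simp add: graph_on_def image_image)
  qed
  show ?thesis
    using scaled_le[of c g] scaled_le[of "inverse c" "\<lambda>x. c *\<^sub>R g x"] assms by simp
qed

lemma hausdorff_dim_graph_on_thin_splitting:
  fixes u v :: "'a::real_normed_vector \<Rightarrow>\<^sub>C (real \<times> real)"
  assumes "0 < s" "K \<subseteq> I" "closed K" and dim: "hausdorff_dim dist (graph_on K u) = ereal s"
    and thin: "\<And>\<rho>. 0 < \<rho> \<Longrightarrow> v \<in> thin_splittings s \<rho> I K u"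
  shows "hausdorff_dim dist (graph_on I v) = ereal s"
proof -
  have "hausdorff_dim dist (graph_on {} u) \<le> ereal (s / 2)"
    unfolding graph_on_def image_empty using \<open>0 < s\<close> by (intro hausdorff_dim_empty_le) simp
  then have "K \<noteq> {}"
    using dim \<open>0 < s\<close> by auto
  have "graph_on K v = graph_on K (\<lambda>x. (1/2) *\<^sub>R u x)"
    using thin[of 1] by (auto simp: thin_splittings_def splittings_def graph_on_def)
  then have "hausdorff_dim dist (graph_on K v) = ereal s"
    using hausdorff_dim_graph_on_scaleR[of "1/2" K u] dim by simp
  moreover have "graph_on I v = graph_on K v \<union> graph_on (I - K) v"
    using \<open>K \<subseteq> I\<close> by (auto simp: graph_on_def)
  ultimately show ?thesis
    using hausdorff_dim_Un_null[OF \<open>0 < s\<close>, of dist "graph_on K v" "graph_on (I - K) v"]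
      thin_splitting_graph_null_off[OF thin \<open>0 < s\<close> \<open>closed K\<close> \<open>K \<noteq> {}\<close>] by simp
qed

lemma graph_restriction_of_exact_dimension:
  fixes g :: "'a::euclidean_space \<Rightarrow> 'b::euclidean_space"
  assumes "compact X" "continuous_on X g" "0 < s" "ereal s \<le> hausdorff_dim dist (graph_on X g)"
  obtains K where "K \<subseteq> X" "compact K" "hausdorff_dim dist (graph_on K g) = ereal s"
proof -
  have "compact (graph_on X g)"
    unfolding graph_on_def using assms by (intro compact_continuous_image continuous_intros)
  then obtain C where C: "C \<subseteq> graph_on X g" "compact C" "hausdorff_dim dist C = ereal s"
    using assms(3,4) by (rule compact_subset_of_exact_dimension)
  then have "graph_on (fst ` C) g = C"
    by (force simp: graph_on_def)
  moreover have "compact (fst ` C)"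
    using C(2) by (intro compact_continuous_image continuous_intros)
  ultimately show thesis
    using that[of "fst ` C"] C(1,3) by (force simp: graph_on_def)
qed

subsection \<open>Interval-valued functions\<close>

lemma infdist_interval:
  fixes x c d :: real
  assumes "c \<le> d"
  shows "infdist x {c..d} = max 0 (max (c - x) (x - d))"
proof -
  have "infdist x {c..d} = (INF y\<in>{c..d}. dist x y)"
    using assms by (simp add: infdist_def)
  also have "\<dots> = max 0 (max (c - x) (x - d))"
  proof (rule cInf_eq_minimum)
    show "max 0 (max (c - x) (x - d)) \<in> dist x ` {c..d}"
      using assms by (intro image_eqI[of _ _ "max c (min d x)"]) (auto simp: dist_real_def)
  qed (auto simp: dist_real_def)
  finally show ?thesis .
qed

lemma SUP_infdist_interval:
  fixes a b c d :: real
  assumes "a \<le> b" "c \<le> d"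
  shows "(SUP x\<in>{a..b}. infdist x {c..d}) = max 0 (max (c - a) (b - d))"
proof (rule cSup_eq_maximum)
  show "max 0 (max (c - a) (b - d)) \<in> (\<lambda>x. infdist x {c..d}) ` {a..b}"
  proof (cases "b - d \<le> c - a")
    case True
    then show ?thesis
      using assms by (intro image_eqI[of _ _ a]) (auto simp: infdist_interval)
  next
    case False
    then show ?thesis
      using assms by (intro image_eqI[of _ _ b]) (auto simp: infdist_interval)
  qed
qed (use assms in \<open>auto simp: infdist_interval\<close>)

lemma hausdorff_dist_interval:
  assumes "a \<le> b" "c \<le> d"
  shows "hausdorff_dist {a..b} {c..d} = max \<bar>a - c\<bar> \<bar>b - d\<bar>"
  unfolding hausdorff_dist_def SUP_infdist_interval[OF assms] SUP_infdist_interval[OF assms(2,1)]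
  by linarith

lemma nearest_interval:
  assumes "c \<le> d"
  shows "nearest {c..d} x = {y \<in> {c..d}. \<bar>x - y\<bar> = max 0 (max (c - x) (x - d))}"
  using infdist_interval[OF assms, of x] assms by (simp add: nearest_def infdist_def dist_real_def)

text \<open>Among the pairs with sum \<open>z\<close>, one whose components are closest to each other is a metric pair.\<close>

lemma ksum_interval:
  assumes "a \<le> b" "c \<le> d"
  shows "ksum {a..b} {c..d} = {a + c..b + d}"
proof
  show "ksum {a..b} {c..d} \<subseteq> {a + c..b + d}"
    by (auto simp: ksum_def Lambda_pairs_def)
  show "{a + c..b + d} \<subseteq> ksum {a..b} {c..d}"
  proof
    fix z assume z: "z \<in> {a + c..b + d}"
    define x where "x = max (max a (z - d)) (min (min b (z - c)) (z / 2))"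
    have x: "x \<in> {a..b}" "z - x \<in> {c..d}"
      using z assms by (auto simp: x_def)
    consider "z - x = x" | "x = a" "z - x \<le> x" | "z - x = d" "z - x \<le> x"
        | "x = b" "x \<le> z - x" | "z - x = c" "x \<le> z - x"
      using z assms unfolding x_def by (smt (verit) field_sum_of_halves atLeastAtMost_iff)
    then have "\<bar>(z - x) - x\<bar> = max 0 (max (a - (z - x)) ((z - x) - b)) \<or>
        \<bar>x - (z - x)\<bar> = max 0 (max (c - x) (x - d))"
      using x by cases auto
    then have "(x, z - x) \<in> Lambda_pairs {a..b} {c..d}"
      unfolding Lambda_pairs_def nearest_interval[OF assms(1)] nearest_interval[OF assms(2)]
      using x by auto
    then show "z \<in> ksum {a..b} {c..d}"
      unfolding ksum_def by (intro CollectI exI[of _ x] exI[of _ "z - x"]) auto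
  qed
qed

definition interval_at :: "real \<times> real \<Rightarrow> real set" where
  "interval_at u = {fst u..fst u + snd u}"

lemma ksum_interval_at:
  "0 \<le> snd u \<Longrightarrow> 0 \<le> snd v \<Longrightarrow> ksum (interval_at u) (interval_at v) = interval_at (u + v)"
  by (simp add: interval_at_def ksum_interval algebra_simps)

lemma Kc_iff_interval_at: "A \<in> Kc \<longleftrightarrow> (\<exists>u. 0 \<le> snd u \<and> A = interval_at u)"
proof
  assume "A \<in> Kc"
  then obtain p q where "p \<le> q" "A = {p..q}"
    using connected_compact_interval_1[of A] by (auto simp: Kc_def convex_connected)
  then show "\<exists>u. 0 \<le> snd u \<and> A = interval_at u"
    by (intro exI[of _ "(p, q - p)"]) (simp add: interval_at_def)
qed (auto simp: Kc_def interval_at_def)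

lemma hausdorff_dist_interval_at:
  assumes "0 \<le> snd u" "0 \<le> snd v"
  shows "hausdorff_dist (interval_at u) (interval_at v) =
    max \<bar>fst u - fst v\<bar> \<bar>(fst u + snd u) - (fst v + snd v)\<bar>"
  unfolding interval_at_def using assms by (intro hausdorff_dist_interval) auto

lemma hausdorff_dist_interval_at_le:
  assumes "0 \<le> snd u" "0 \<le> snd v"
  shows "hausdorff_dist (interval_at u) (interval_at v) \<le> 2 * dist u v"
proof -
  have "\<bar>fst u - fst v\<bar> \<le> dist u v" "\<bar>snd u - snd v\<bar> \<le> dist u v"
    using dist_fst_le[of u v] dist_snd_le[of u v] by (simp_all add: dist_real_def)
  then show ?thesis
    unfolding hausdorff_dist_interval_at[OF assms] by linarith
qed

lemma dist_Pair_le: "dist (x, y) (x', y') \<le> dist x x' + dist y y'"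
  unfolding dist_Pair_Pair by (intro sqrt_sum_squares_le_sum) auto

lemma dist_le_hausdorff_dist_interval_at:
  assumes "0 \<le> snd u" "0 \<le> snd v"
  shows "dist u v \<le> 3 * hausdorff_dist (interval_at u) (interval_at v)"
proof -
  have "dist u v \<le> \<bar>fst u - fst v\<bar> + \<bar>snd u - snd v\<bar>"
    using dist_Pair_le[of "fst u" "snd u" "fst v" "snd v"] by (simp add: dist_real_def)
  then show ?thesis
    unfolding hausdorff_dist_interval_at[OF assms] by (smt (verit))
qed

lemma cont_Kc_cong: "(\<And>x. x \<in> I \<Longrightarrow> f x = g x) \<Longrightarrow> cont_Kc I f \<longleftrightarrow> cont_Kc I g"
  by (simp add: cont_Kc_def)

lemma cont_Kc_interval_at_iff:
  assumes "\<And>x. x \<in> I \<Longrightarrow> 0 \<le> snd (u x)"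
  shows "cont_Kc I (\<lambda>x. interval_at (u x)) \<longleftrightarrow> continuous_on I u"
proof
  assume cont: "cont_Kc I (\<lambda>x. interval_at (u x))"
  show "continuous_on I u"
    unfolding continuous_on_iff
  proof (intro ballI allI impI)
    fix x and e :: real assume "x \<in> I" "0 < e"
    then have "0 < e / 3" by simp
    then obtain d where d: "0 < d" "\<And>y. y \<in> I \<Longrightarrow> \<bar>y - x\<bar> < d \<Longrightarrow>
        hausdorff_dist (interval_at (u y)) (interval_at (u x)) < e / 3"
      using cont \<open>x \<in> I\<close> unfolding cont_Kc_def by blast
    have "dist (u y) (u x) < e" if "y \<in> I" "dist y x < d" for y
      using dist_le_hausdorff_dist_interval_at[of "u y" "u x"] assms d(2)[of y] that \<open>x \<in> I\<close>
      by (simp add: dist_real_def)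
    then show "\<exists>d>0. \<forall>y\<in>I. dist y x < d \<longrightarrow> dist (u y) (u x) < e"
      using d(1) by blast
  qed
next
  assume cont: "continuous_on I u"
  have "\<exists>d>0. \<forall>y\<in>I. \<bar>y - x\<bar> < d \<longrightarrow> hausdorff_dist (interval_at (u y)) (interval_at (u x)) < e"
    if "x \<in> I" "0 < e" for x e
  proof -
    obtain d where d: "0 < d" "\<And>y. y \<in> I \<Longrightarrow> dist y x < d \<Longrightarrow> dist (u y) (u x) < e / 2"
      using cont \<open>x \<in> I\<close> half_gt_zero[OF \<open>0 < e\<close>] unfolding continuous_on_iff by meson
    have "hausdorff_dist (interval_at (u y)) (interval_at (u x)) < e" if "y \<in> I" "\<bar>y - x\<bar> < d" for y
      using hausdorff_dist_interval_at_le[of "u y" "u x"] assms d(2)[of y] that \<open>x \<in> I\<close>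
      by (simp add: dist_real_def)
    then show ?thesis
      using d(1) by blast
  qed
  then show "cont_Kc I (\<lambda>x. interval_at (u x))"
    unfolding cont_Kc_def Kc_iff_interval_at using assms by blast
qed

lemma cont_Kc_bcontfunE:
  assumes "cont_Kc {a..b} f"
  obtains u :: "real \<Rightarrow>\<^sub>C (real \<times> real)"
  where "\<And>x. x \<in> {a..b} \<Longrightarrow> 0 \<le> snd (u x)" "\<And>x. x \<in> {a..b} \<Longrightarrow> f x = interval_at (u x)"
proof -
  have "\<forall>x\<in>{a..b}. \<exists>y. 0 \<le> snd y \<and> f x = interval_at y"
    using assms unfolding cont_Kc_def Kc_iff_interval_at by (rule conjunct1)
  then obtain g where g: "\<And>x. x \<in> {a..b} \<Longrightarrow> 0 \<le> snd (g x)" "\<And>x. x \<in> {a..b} \<Longrightarrow> f x = interval_at (g x)"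
    by metis
  have "cont_Kc {a..b} (\<lambda>x. interval_at (g x))"
    by (rule cont_Kc_cong[THEN iffD1, OF _ assms]) (rule g(2))
  then have "continuous_on (cbox a b) g"
    using cont_Kc_interval_at_iff[where I = "{a..b}", OF g(1)] by simp
  then obtain u :: "real \<Rightarrow>\<^sub>C (real \<times> real)" where "\<And>x. x \<in> cbox a b \<Longrightarrow> u x = g x"
    by (rule continuous_on_cbox_bcontfunE) (rule that)
  then show thesis
    using g by (intro that[of u]) auto
qed

lemma graph_metric_interval_at_le:
  assumes "0 \<le> snd u" "0 \<le> snd v"
  shows "graph_metric (x, interval_at u) (y, interval_at v) \<le> 3 * dist (x, u) (y, v)"
  unfolding graph_metric_def fst_conv snd_conv
  using hausdorff_dist_interval_at_le[OF assms] dist_snd_le[of "(x, u)" "(y, v)", simplified]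
    dist_fst_le[of "(x, u)" "(y, v)", simplified, unfolded dist_real_def]
  by argo

lemma dist_le_graph_metric_interval_at:
  assumes "0 \<le> snd u" "0 \<le> snd v"
  shows "dist (x, u) (y, v) \<le> 3 * graph_metric (x, interval_at u) (y, interval_at v)"
  unfolding graph_metric_def fst_conv snd_conv
  using dist_le_hausdorff_dist_interval_at[OF assms] dist_Pair_le[of x u y v, unfolded dist_real_def]
  by argo

lemma graph_star_eq_graph_on: "graph_star A g = graph_on A g"
  by (auto simp: graph_star_def graph_on_def)

lemma hausdorff_dim_graph_star_interval_at:
  assumes f: "\<And>x. x \<in> A \<Longrightarrow> f x = interval_at (u x)" and nonneg: "\<And>x. x \<in> A \<Longrightarrow> 0 \<le> snd (u x)"
  shows "hausdorff_dim graph_metric (graph_star A f) = hausdorff_dim dist (graph_on A u)"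
proof (rule antisym)
  have "graph_star A f = (\<lambda>z. (fst z, interval_at (snd z))) ` graph_on A u"
    using f by (simp add: graph_star_eq_graph_on graph_on_def image_image)
  also have "hausdorff_dim graph_metric \<dots> \<le> hausdorff_dim dist (graph_on A u)"
    using nonneg by (intro hausdorff_dim_Lipschitz_image[of 3])
      (auto simp: graph_on_def graph_metric_interval_at_le simp del: prod.collapse)
  finally show "hausdorff_dim graph_metric (graph_star A f) \<le> hausdorff_dim dist (graph_on A u)" .
  have "graph_on A u = (\<lambda>z. (fst z, u (fst z))) ` graph_star A f"
    by (simp add: graph_star_eq_graph_on graph_on_def image_image)
  also have "hausdorff_dim dist \<dots> \<le> hausdorff_dim graph_metric (graph_star A f)"
    using f nonneg by (intro hausdorff_dim_Lipschitz_image[of 3])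
      (auto simp: graph_star_def dist_le_graph_metric_interval_at)
  finally show "hausdorff_dim dist (graph_on A u) \<le> hausdorff_dim graph_metric (graph_star A f)" .
qed

lemma interval_at_in_D_beta:
  assumes "continuous_on {a..b} v" "\<And>x. x \<in> {a..b} \<Longrightarrow> 0 \<le> snd (v x)"
    and "hausdorff_dim dist (graph_on {a..b} v) = ereal \<beta>"
  shows "(\<lambda>x. interval_at (v x)) \<in> D_beta {a..b} \<beta>"
  using assms(1,3) cont_Kc_interval_at_iff[where I = "{a..b}", OF assms(2)]
    hausdorff_dim_graph_star_interval_at[where A = "{a..b}", OF refl assms(2)]
  by (simp add: D_beta_def)

lemma thin_splitting_in_D_beta:
  fixes u v :: "real \<Rightarrow>\<^sub>C (real \<times> real)"
  assumes "0 < \<beta>" "K \<subseteq> {a..b}" "closed K" "hausdorff_dim dist (graph_on K u) = ereal \<beta>"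
    and thin: "\<And>\<rho>. 0 < \<rho> \<Longrightarrow> v \<in> thin_splittings \<beta> \<rho> {a..b} K u"
  shows "(\<lambda>x. interval_at (v x)) \<in> D_beta {a..b} \<beta>"
  using hausdorff_dim_graph_on_thin_splitting[OF assms] thin[of 1]
  by (intro interval_at_in_D_beta) (auto simp: thin_splittings_def splittings_def)

theorem theorem4p19:
  fixes a b \<beta> :: real and f :: "real \<Rightarrow> real set"
  assumes "a < b"
    and "\<beta> > 1"
    and "cont_Kc {a..b} f"
    and "hausdorff_dim graph_metric (graph_star {a..b} f) \<ge> ereal \<beta>"
  shows "\<exists>g h. g \<in> D_beta {a..b} \<beta> \<and> h \<in> D_beta {a..b} \<beta> \<and>
               (\<forall>x\<in>{a..b}. f x = ksum (g x) (h x))"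
proof -
  have \<beta>: "0 < \<beta>" and ab: "a \<le> b"
    using assms(1,2) by simp_all
  obtain u :: "real \<Rightarrow>\<^sub>C (real \<times> real)" where nonneg: "\<And>x. x \<in> {a..b} \<Longrightarrow> 0 \<le> snd (u x)"
      and f: "\<And>x. x \<in> {a..b} \<Longrightarrow> f x = interval_at (u x)"
    by (rule cont_Kc_bcontfunE[OF assms(3)]) (rule that)
  have "ereal \<beta> \<le> hausdorff_dim dist (graph_on {a..b} u)"
    using assms(4) hausdorff_dim_graph_star_interval_at[where A = "{a..b}", OF f nonneg] by simp
  then obtain K where K: "K \<subseteq> {a..b}" "compact K" "hausdorff_dim dist (graph_on K u) = ereal \<beta>"
    by (rule graph_restriction_of_exact_dimension[OF compact_Icc continuous_on_apply_bcontfun \<beta>])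
      (rule that)
  obtain v where v: "\<And>\<rho>. 0 < \<rho> \<Longrightarrow>
      v \<in> thin_splittings \<beta> \<rho> {a..b} K u \<and> u - v \<in> thin_splittings \<beta> \<rho> {a..b} K u"
    using thin_splitting_exists[OF ab K(1) assms(2) nonneg] by blast
  note in_D_beta = thin_splitting_in_D_beta[OF \<beta> K(1) compact_imp_closed[OF K(2)] K(3)]
  have "(\<lambda>x. interval_at (v x)) \<in> D_beta {a..b} \<beta>" "(\<lambda>x. interval_at ((u - v) x)) \<in> D_beta {a..b} \<beta>"
    using v by (blast intro: in_D_beta)+
  moreover have "f x = ksum (interval_at (v x)) (interval_at ((u - v) x))" if "x \<in> {a..b}" for x
    using v[of 1] that f by (simp add: thin_splittings_def splittings_def ksum_interval_at)
  ultimately show ?thesis by blast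
qed

end
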